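(* Let $A,B$ be two solid, closed, convex sets in $\mathbb{R}^n$, and let $x^*\in A\cap B$ be the limit point of the sequence $(x_k)$ generated by the GAP algorithm $x_{k+1}=(1-\alpha)x_k+\alpha\Pi_A^{\alpha_2}\Pi_B^{\alpha_1}x_k$. Assume that $x^*\in\operatorname{bd}A\cap\operatorname{bd}B$ and that $(\operatorname{bd}A,\operatorname{bd}B)$ satisfy the regularity assumption at $x^*$. Then the sets are $\hat\kappa$-linearly regular at $x^*$, i.e. there exist $\delta>0$ and $\hat\kappa>0$ with $$d_{A\cap B}(x)\le\hat\kappa\max(d_A(x),d_B(x))\quad\forall x\in\mathcal{B}_\delta(x^* ).$$ Let $\kappa$ be the infimum of all such $\hat\kappa$ and assume $\kappa\ge\sqrt2$. Then the GAP algorithm with parameters $$\alpha=1,\quad\alpha_1=\alpha_2=2\left(\frac{\kappa}{\sqrt{\kappa^2-1}+1}\right)^2$$ converges to $x^*$ R-linearly with rate $\mu$ for any $\mu\in(\gamma,1)$, where $$\gamma=\left(\frac{\sqrt{\kappa^2-1}-1}{\sqrt{\kappa^2-1}+1}\right)^2=1-4\frac{\sqrt{\kappa^2-1}}{\kappa^2+2\sqrt{\kappa^2-1}}.$$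
   Context: Solid means nonempty interior; $\Pi_C$ is the projection onto $C$, $\Pi_C^\alpha:=(1-\alpha)I+\alpha\Pi_C$; $d_C$ is the distance to $C$; $\mathcal{B}_\delta(x)$ is the closed ball. A set $\mathcal{M}$ is a $\mathcal{C}^k$-manifold around $x$ if there is an open $U\ni x$ with $\mathcal{M}\cap U=\{y:F(y)=0\}$ for a $\mathcal{C}^k$ map $F:U\to\mathbb{R}^d$ with surjective derivative throughout $U$; $T_{\mathcal{M}}(x)=\ker DF(x)$. Regularity assumption at $x$: $\mathcal{M},\mathcal{N}$ are $\mathcal{C}^k$-smooth ($k\ge2$) around $x\in\mathcal{M}\cap\mathcal{N}$, $\mathcal{M}\cap\mathcal{N}$ is a $\mathcal{C}^k$ manifold around $x$, and $T_{\mathcal{M}\cap\mathcal{N}}(x)=T_{\mathcal{M}}(x)\cap T_{\mathcal{N}}(x)$. R-linear convergence with rate $\mu$: there is $C>0$ with $\|x_k-x^*\|\le C\mu^k$ for all $k$. *)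

theory Defs
  imports "HOL-Analysis.Analysis"
begin

fun Ck_on :: "nat \<Rightarrow> 'a::euclidean_space set \<Rightarrow> ('a \<Rightarrow> real) \<Rightarrow> bool" where
  "Ck_on 0 U f = continuous_on U f"
| "Ck_on (Suc k) U f =
     ((\<forall>y\<in>U. f differentiable (at y)) \<and>
      (\<forall>i\<in>Basis. Ck_on k U (\<lambda>y. frechet_derivative f (at y) i)))"

definition manifold_chart ::
  "nat \<Rightarrow> 'a::euclidean_space set \<Rightarrow> 'a \<Rightarrow> 'a set \<Rightarrow> nat \<Rightarrow> ('a \<Rightarrow> nat \<Rightarrow> real) \<Rightarrow> bool" where
  "manifold_chart k M x U d F \<longleftrightarrow>
     open U \<and> x \<in> U \<and>
     (\<forall>j<d. Ck_on k U (\<lambda>y. F y j)) \<and>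
     (\<forall>y\<in>U. \<forall>c::nat \<Rightarrow> real. \<exists>v. \<forall>j<d. frechet_derivative (\<lambda>z. F z j) (at y) v = c j) \<and>
     M \<inter> U = {y\<in>U. \<forall>j<d. F y j = 0}"

definition Ck_manifold_around :: "nat \<Rightarrow> 'a::euclidean_space set \<Rightarrow> 'a \<Rightarrow> bool" where
  "Ck_manifold_around k M x \<longleftrightarrow> (\<exists>U d F. manifold_chart k M x U d F)"

definition tangent_space :: "nat \<Rightarrow> 'a::euclidean_space set \<Rightarrow> 'a \<Rightarrow> 'a set" where
  "tangent_space k M x =
     (case (SOME (U, d, F). manifold_chart k M x U d F) of (U, d, F) \<Rightarrow>
        {v. \<forall>j<d. frechet_derivative (\<lambda>z. F z j) (at x) v = 0})"

definition regularity_assumption :: "nat \<Rightarrow> 'a::euclidean_space set \<Rightarrow> 'a set \<Rightarrow> 'a \<Rightarrow> bool" where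
  "regularity_assumption k M N x \<longleftrightarrow>
     2 \<le> k \<and> x \<in> M \<inter> N \<and>
     Ck_manifold_around k M x \<and> Ck_manifold_around k N x \<and>
     Ck_manifold_around k (M \<inter> N) x \<and>
     tangent_space k (M \<inter> N) x = tangent_space k M x \<inter> tangent_space k N x"

definition solid :: "'a::euclidean_space set \<Rightarrow> bool" where
  "solid C \<longleftrightarrow> interior C \<noteq> {}"

definition relaxed_proj :: "real \<Rightarrow> 'a::euclidean_space set \<Rightarrow> 'a \<Rightarrow> 'a" where
  "relaxed_proj \<alpha> C x = (1 - \<alpha>) *\<^sub>R x + \<alpha> *\<^sub>R closest_point C x"

definition gap_step :: "real \<Rightarrow> real \<Rightarrow> real \<Rightarrow> 'a::euclidean_space set \<Rightarrow> 'a set \<Rightarrow> 'a \<Rightarrow> 'a" where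
  "gap_step \<alpha> \<alpha>1 \<alpha>2 A B x =
     (1 - \<alpha>) *\<^sub>R x + \<alpha> *\<^sub>R relaxed_proj \<alpha>2 A (relaxed_proj \<alpha>1 B x)"

definition lin_regular_const :: "'a::euclidean_space set \<Rightarrow> 'a set \<Rightarrow> 'a \<Rightarrow> real \<Rightarrow> bool" where
  "lin_regular_const A B x \<kappa> \<longleftrightarrow> \<kappa> > 0 \<and>
     (\<exists>\<delta>>0. \<forall>y\<in>cball x \<delta>. infdist y (A \<inter> B) \<le> \<kappa> * max (infdist y A) (infdist y B))"

definition R_linear_conv :: "(nat \<Rightarrow> 'a::real_normed_vector) \<Rightarrow> 'a \<Rightarrow> real \<Rightarrow> bool" where
  "R_linear_conv xs xstar \<mu> \<longleftrightarrow> (\<exists>C>0. \<forall>k. norm (xs k - xstar) \<le> C * \<mu> ^ k)"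

end

theory Submission
  imports Defs
begin

text \<open>
  Smoothness of the frontier of a convex set \<open>C\<close> at \<open>x\<close> enters only through the uniqueness of the
  outer unit normal \<open>n\<close> of \<open>C\<close> at \<open>x\<close>. By compactness the unit vectors along
  \<open>u - closest_point C u\<close> tend to \<open>n\<close> as \<open>u\<close> tends to \<open>x\<close>, and convexity turns this into the local
  estimate \<open>infdist u' C \<le> max 0 (infdist u C + n \<bullet> (u' - u) + e * norm (u' - u))\<close>.

  Let \<open>nA\<close>, \<open>nB\<close> be the two normals. If \<open>nB = - nA\<close>, the regularity assumption forces \<open>A \<inter> B\<close> to be
  the common tangent hyperplane near \<open>x\<close>, and then \<open>\<kappa> \<le> 1\<close>. Otherwise the estimate yields
  \<open>\<kappa> = 2 / norm (nA + nB)\<close>. In that case put \<open>\<rho> = (s - 1) / (s + 1)\<close> with \<open>s = sqrt (\<kappa>\<^sup>2 - 1)\<close>;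
  the relaxation parameter is \<open>1 + \<rho>\<^sup>2\<close>, and its product with \<open>nA \<bullet> nB\<close> is \<open>- 2 * \<rho>\<close>. Hence the
  successive distances \<open>z\<close> to \<open>B\<close> and \<open>A\<close>, each measured just before the projection, satisfy
  \<open>z (j + 2) \<le> max 0 (2 * \<rho> * z (j + 1) - \<rho>\<^sup>2 * z j)\<close> up to relative errors that tend to zero. The
  characteristic polynomial has the double root \<open>\<rho>\<close>, so \<open>z\<close> decays at every rate above \<open>\<rho>\<close>.
  One GAP step consists of two projections, which gives every rate above \<open>\<gamma> = \<rho>\<^sup>2\<close>.
\<close>

section \<open>Distance estimates near a point with a unique normal\<close>

text \<open>Membership of \<open>v\<close> in the normal cone of \<open>C\<close> at
  \<open>x\<close>. The zero vector belongs to it, hence the separate nonzero or unit conditions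
  wherever a direction matters.\<close>

definition outer_normal :: "'a::euclidean_space set \<Rightarrow> 'a \<Rightarrow> 'a \<Rightarrow> bool" where
  "outer_normal C x v \<longleftrightarrow> (\<forall>z\<in>C. v \<bullet> (z - x) \<le> 0)"

definition unique_unit_normal :: "'a::euclidean_space set \<Rightarrow> 'a \<Rightarrow> 'a \<Rightarrow> bool" where
  "unique_unit_normal C x n \<longleftrightarrow>
     norm n = 1 \<and> outer_normal C x n \<and> (\<forall>v. norm v = 1 \<and> outer_normal C x v \<longrightarrow> v = n)"

lemma infdist_closest_point:
  fixes C :: "'a::euclidean_space set"
  assumes "closed C" "C \<noteq> {}"
  shows "infdist x C = norm (x - closest_point C x)"
  using setdist_closest_point[OF assms] by (simp add: infdist_eq_setdist dist_norm)

text \<open>For nonzero \<open>v\<close> the set \<open>C\<close> lies in the half-space of all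
  \<open>z\<close> with \<open>v \<bullet> (z - x) \<le> 0\<close>, and
  \<open>v \<bullet> (y - x)\<close> divided by \<open>norm v\<close> is the signed distance of
  \<open>y\<close> from it.\<close>

lemma inner_le_infdist_if_outer_normal:
  fixes C :: "'a::euclidean_space set"
  assumes "outer_normal C x v" "C \<noteq> {}"
  shows "v \<bullet> (y - x) \<le> norm v * infdist y C"
proof (cases "v = 0")
  case False
  have "(v \<bullet> (y - x)) / norm v \<le> dist y z" if "z \<in> C" for z
  proof -
    have "v \<bullet> (y - x) = v \<bullet> (y - z) + v \<bullet> (z - x)" by (simp add: inner_diff_right)
    also have "\<dots> \<le> norm v * dist y z"
      using norm_cauchy_schwarz[of v "y - z"] assms(1) that
      unfolding outer_normal_def dist_norm by fastforce
    finally show ?thesis using False by (simp add: field_simps)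
  qed
  then have "(v \<bullet> (y - x)) / norm v \<le> infdist y C"
    using assms(2) by (simp add: infdist_def cINF_greatest)
  then show ?thesis using False by (simp add: field_simps)
qed simp

text \<open>Otherwise the normalised residuals along some sequence tending to \<open>x\<close> stay
  more than \<open>e\<close> away from \<open>n\<close>. A subsequence converges to a unit vector,
  and the variational inequality of the projection makes this limit an outer normal at
  \<open>x\<close>, hence equal to \<open>n\<close>.\<close>

lemma closest_point_residual_near_normal:
  fixes C :: "'a::euclidean_space set"
  assumes C: "closed C" "convex C" "x \<in> C" and n: "unique_unit_normal C x n" and "e > 0"
  shows "\<forall>\<^sub>F u in nhds x. norm (u - closest_point C u - infdist u C *\<^sub>R n) \<le> e * infdist u C"
proof (rule ccontr)
  have ne: "C \<noteq> {}" using C by auto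
  let ?P = "\<lambda>u. norm (u - closest_point C u - infdist u C *\<^sub>R n) \<le> e * infdist u C"
  assume not: "\<not> (\<forall>\<^sub>F u in nhds x. ?P u)"
  have "\<exists>u. dist u x < inverse (real (Suc i)) \<and> \<not> ?P u" for i
    using not unfolding eventually_nhds_metric by (auto simp del: of_nat_Suc)
  then obtain u where u: "dist (u i) x < inverse (real (Suc i))" and nP: "\<not> ?P (u i)" for i
    by metis
  have ulim: "u \<longlonglongrightarrow> x"
    unfolding tendsto_iff
  proof (intro allI impI)
    fix d :: real assume "d > 0"
    then have "\<forall>\<^sub>F i in sequentially. inverse (real (Suc i)) < d"
      by (rule order_tendstoD(2)[OF LIMSEQ_inverse_real_of_nat])
    then show "\<forall>\<^sub>F i in sequentially. dist (u i) x < d"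
      by eventually_elim (use u less_trans in blast)
  qed
  define v where "v i = (u i - closest_point C (u i)) /\<^sub>R infdist (u i) C" for i
  \<comment> \<open>On \<open>C\<close> both sides of \<open>?P\<close> vanish, so a violating point
    lies outside \<open>C\<close>.\<close>
  have pos: "infdist (u i) C > 0" for i
  proof -
    have "infdist (u i) C \<noteq> 0"
      using nP[of i] infdist_closest_point[OF C(1) ne, of "u i"] by auto
    then show ?thesis using infdist_nonneg[of "u i" C] by linarith
  qed
  have nv: "norm (v i) = 1" for i
    using pos[of i] infdist_closest_point[OF C(1) ne, of "u i"] by (simp add: v_def)
  have far: "norm (v i - n) > e" for i
  proof -
    have "u i - closest_point C (u i) - infdist (u i) C *\<^sub>R n = infdist (u i) C *\<^sub>R (v i - n)"
      using pos[of i] by (simp add: v_def algebra_simps)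
    then show ?thesis using nP[of i] pos[of i] by (simp add: not_le mult.commute)
  qed
  have "compact (sphere (0::'a) 1)" by simp
  then obtain l r where l: "l \<in> sphere 0 1" and r: "strict_mono (r::nat \<Rightarrow> nat)"
    and lim: "(v \<circ> r) \<longlonglongrightarrow> l"
    unfolding compact_def using nv by (metis mem_sphere_0)
  have ur: "(\<lambda>i. u (r i)) \<longlonglongrightarrow> x"
    using LIMSEQ_subseq_LIMSEQ[OF ulim r] by (simp add: o_def)
  have cl: "(\<lambda>i. closest_point C (u (r i))) \<longlonglongrightarrow> x"
    using isCont_tendsto_compose[OF continuous_at_closest_point[OF C(2,1) ne] ur] C
    by (simp add: closest_point_self)
  have vn: "v i \<bullet> (z - closest_point C (u i)) \<le> 0" if "z \<in> C" for i z
    using closest_point_dot[OF C(2,1) that, of "u i"] pos[of i]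
    by (simp add: v_def mult_nonneg_nonpos)
  have "outer_normal C x l"
    unfolding outer_normal_def
  proof
    fix z assume "z \<in> C"
    have "(\<lambda>i. v (r i) \<bullet> (z - closest_point C (u (r i)))) \<longlonglongrightarrow> l \<bullet> (z - x)"
      using lim cl by (intro tendsto_intros) (auto simp: o_def)
    then show "l \<bullet> (z - x) \<le> 0"
      using vn[OF \<open>z \<in> C\<close>] by (intro LIMSEQ_le_const2) auto
  qed
  then have "l = n" using n l unfolding unique_unit_normal_def by auto
  moreover have "(\<lambda>i. norm (v (r i) - n)) \<longlonglongrightarrow> norm (l - n)"
    using lim by (intro tendsto_intros) (auto simp: o_def)
  then have "e \<le> norm (l - n)"
    by (rule LIMSEQ_le_const) (use far less_imp_le in blast)
  ultimately show False using \<open>e > 0\<close> by simp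
qed

text \<open>Let \<open>w\<close> be the residual at \<open>u'\<close> and \<open>d\<close> its norm.
  Splitting \<open>w \<bullet> w\<close> at \<open>u\<close> and at the two closest points gives a
  term near \<open>d * (n \<bullet> (u' - u))\<close>, a Cauchy-Schwarz term and a term that is
  nonpositive by convexity; then divide by \<open>d\<close>. Closeness to \<open>n\<close> concerns
  \<open>u'\<close> only, and \<open>u\<close> is arbitrary.\<close>

lemma infdist_le_linearized:
  fixes C :: "'a::euclidean_space set"
  assumes C: "closed C" "convex C" "C \<noteq> {}"
    and u': "norm (u' - closest_point C u' - infdist u' C *\<^sub>R n) \<le> e * infdist u' C"
  shows "infdist u' C \<le> max 0 (infdist u C + n \<bullet> (u' - u) + e * norm (u' - u))"
proof (cases "infdist u' C = 0")
  case False
  define d where "d = infdist u' C"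
  define w where "w = u' - closest_point C u'"
  have d: "d > 0" using False infdist_nonneg[of u' C] by (simp add: d_def)
  have nw: "norm w = d" using infdist_closest_point[OF C(1,3)] by (simp add: d_def w_def)
  have "d * d = w \<bullet> w" using nw by (metis power2_norm_eq_inner power2_eq_square)
  also have "\<dots> = w \<bullet> (u' - u) + w \<bullet> (u - closest_point C u)
      + w \<bullet> (closest_point C u - closest_point C u')"
    by (subst (2) w_def) (simp add: algebra_simps)
  also have "w \<bullet> (closest_point C u - closest_point C u') \<le> 0"
    unfolding w_def by (rule closest_point_dot) (use C closest_point_in_set in auto)
  also have "w \<bullet> (u - closest_point C u) \<le> d * infdist u C"
    using norm_cauchy_schwarz[of w "u - closest_point C u"] nw infdist_closest_point[OF C(1,3), of u]
    by simp
  also have "w \<bullet> (u' - u) \<le> d * (n \<bullet> (u' - u)) + e * d * norm (u' - u)"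
  proof -
    have "w \<bullet> (u' - u) = d * (n \<bullet> (u' - u)) + (w - d *\<^sub>R n) \<bullet> (u' - u)"
      by (simp add: inner_diff_left)
    also have "(w - d *\<^sub>R n) \<bullet> (u' - u) \<le> norm (w - d *\<^sub>R n) * norm (u' - u)"
      by (rule norm_cauchy_schwarz)
    also have "\<dots> \<le> (e * d) * norm (u' - u)"
      using u' by (intro mult_right_mono) (auto simp: d_def w_def)
    finally show ?thesis by simp
  qed
  finally have "d * d \<le> d * (infdist u C + n \<bullet> (u' - u) + e * norm (u' - u))"
    by (simp add: algebra_simps)
  then have "d \<le> infdist u C + n \<bullet> (u' - u) + e * norm (u' - u)"
    using d by simp
  then show ?thesis by (simp add: d_def)
qed auto

section \<open>Normals of convex sets with smooth frontier\<close>

text \<open>Around \<open>z\<close> there is room to move by \<open>r\<close> along \<open>v\<close>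
  inside \<open>C\<close>, which raises the inner product by \<open>r * norm v\<close>.\<close>

lemma outer_normal_interior_neg:
  fixes C :: "'a::euclidean_space set"
  assumes v: "outer_normal C x v" "v \<noteq> 0" and z: "z \<in> interior C"
  shows "v \<bullet> (z - x) < 0"
proof -
  obtain r where r: "r > 0" "cball z r \<subseteq> C" using z by (auto simp: mem_interior_cball)
  let ?z = "z + (r / norm v) *\<^sub>R v"
  have "?z \<in> C" using r v(2) by (intro subsetD[OF r(2)]) (simp add: dist_norm)
  then have "v \<bullet> (?z - x) \<le> 0" using v(1) unfolding outer_normal_def by blast
  moreover have "v \<bullet> (?z - x) = v \<bullet> (z - x) + r * norm v"
    using v(2) by (simp add: inner_diff_right inner_add_right power2_norm_eq_inner[symmetric]
        power2_eq_square)
  moreover have "r * norm v > 0" using r v(2) by simp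
  ultimately show ?thesis by linarith
qed

text \<open>Along each direction \<open>h\<close> the frontier, seen from an interior point, is a Lipschitz graph,
  so a limit argument gives a tangential direction of the form \<open>h + \<sigma> *\<^sub>R (z\<^sub>0 - x)\<close>.\<close>

lemma frontier_tangent_direction:
  fixes C :: "'a::euclidean_space set"
  assumes C: "closed C" "convex C" and x: "x \<in> frontier C" and z: "z\<^sub>0 \<in> interior C"
    and f: "(f has_derivative D) (at x)" and U: "open U" "x \<in> U"
    and f0: "\<And>y. y \<in> frontier C \<inter> U \<Longrightarrow> f y = 0"
  obtains \<sigma> where "D (h + \<sigma> *\<^sub>R (z\<^sub>0 - x)) = (0::real)"
    "\<And>v. outer_normal C x v \<Longrightarrow> v \<bullet> (h + \<sigma> *\<^sub>R (z\<^sub>0 - x)) \<le> 0"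
proof -
  define e where "e = z\<^sub>0 - x"
  have xC: "x \<in> C" and xi: "x \<notin> interior C"
    using x C(1) by (auto simp: frontier_def)
  obtain r where r: "r > 0" "ball z\<^sub>0 r \<subseteq> C"
    using z by (auto simp: mem_interior)
  have rint: "ball z\<^sub>0 r \<subseteq> interior C" using r(2) by (simp add: interior_maximal)
  \<comment> \<open>With \<open>L\<close> above \<open>norm h / r\<close>, both
    \<open>z\<^sub>0 + h /\<^sub>R L\<close> and \<open>z\<^sub>0 - h /\<^sub>R L\<close> lie in the
    ball inside \<open>C\<close>.\<close>
  define L where "L = norm h / r + 1"
  have L: "L > 0" "norm h < L * r"
    using r by (auto simp: L_def field_simps add_pos_nonneg)
  define t where "t i = inverse (L * real (Suc i))" for i
  have t: "t i > 0" "L * t i \<le> 1" for i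
  proof -
    show "t i > 0" using L by (simp add: t_def)
    have "L * t i = inverse (real (Suc i))" using L by (simp add: t_def del: of_nat_Suc)
    then show "L * t i \<le> 1" by (simp add: inverse_le_1_iff)
  qed
  have tlim: "t \<longlonglongrightarrow> 0"
    using tendsto_mult[OF tendsto_const[of "inverse L"] LIMSEQ_inverse_real_of_nat]
    by (simp add: t_def[abs_def])
  have ball: "z\<^sub>0 + h /\<^sub>R L \<in> ball z\<^sub>0 r" "z\<^sub>0 - h /\<^sub>R L \<in> ball z\<^sub>0 r"
    using L by (auto simp: dist_norm field_simps)
  have "\<exists>s. \<bar>s\<bar> \<le> L \<and> x + t i *\<^sub>R (h + s *\<^sub>R e) \<in> frontier C" for i
  proof -
    let ?g = "\<lambda>s. x + t i *\<^sub>R (h + s *\<^sub>R e)"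
    have "?g L \<in> C"
    proof -
      have "(1 - L * t i) *\<^sub>R x + (L * t i) *\<^sub>R (z\<^sub>0 + h /\<^sub>R L) \<in> C"
        using C(2) xC ball r(2) t[of i] L by (intro convexD) auto
      also have "(1 - L * t i) *\<^sub>R x + (L * t i) *\<^sub>R (z\<^sub>0 + h /\<^sub>R L) = ?g L"
        using L by (simp add: e_def algebra_simps)
      finally show ?thesis .
    qed
    \<comment> \<open>Otherwise \<open>x\<close> would be a proper convex combination of
      \<open>?g (- L)\<close> and the interior point \<open>z\<^sub>0 - h /\<^sub>R L\<close>, hence
      interior itself.\<close>
    moreover have "?g (- L) \<notin> C"
    proof
      assume gC: "?g (- L) \<in> C"
      define \<theta> where "\<theta> = L * t i / (1 + L * t i)"
      have Lt: "L * t i > 0" using L t by simp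
      have \<theta>: "0 < \<theta>" "\<theta> \<le> 1" using Lt by (auto simp: \<theta>_def field_simps)
      have "?g (- L) - \<theta> *\<^sub>R (?g (- L) - (z\<^sub>0 - h /\<^sub>R L)) \<in> interior C"
        using mem_interior_convex_shrink[OF C(2) _ gC \<theta>] ball rint by blast
      moreover have "?g (- L) - \<theta> *\<^sub>R (?g (- L) - (z\<^sub>0 - h /\<^sub>R L)) = x"
      proof -
        have "(1 + L * t i) *\<^sub>R (?g (- L) - \<theta> *\<^sub>R (?g (- L) - (z\<^sub>0 - h /\<^sub>R L)))
            = (1 + L * t i) *\<^sub>R ?g (- L) - (L * t i) *\<^sub>R (?g (- L) - (z\<^sub>0 - h /\<^sub>R L))"
          using Lt by (simp add: \<theta>_def scaleR_diff_right)
        also have "\<dots> = (1 + L * t i) *\<^sub>R x"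
          using L by (simp add: e_def algebra_simps)
        finally show ?thesis using Lt by simp
      qed
      ultimately show False using xi by simp
    qed
    moreover have "connected (?g ` {-L..L})"
      by (intro connected_continuous_image continuous_intros connected_Icc)
    moreover have "?g L \<in> ?g ` {-L..L}" "?g (- L) \<in> ?g ` {-L..L}"
      by (rule imageI, use L in simp)+
    ultimately have "?g ` {-L..L} \<inter> frontier C \<noteq> {}"
      by (intro connected_Int_frontier) blast+
    then obtain s where "s \<in> {-L..L}" "?g s \<in> frontier C" by blast
    then show ?thesis by (intro exI[of _ s]) (simp add: abs_le_iff)
  qed
  then obtain s where s: "\<bar>s i\<bar> \<le> L" "x + t i *\<^sub>R (h + s i *\<^sub>R e) \<in> frontier C" for i
    by metis
  have "compact {-L..L}" by simp
  moreover have "\<forall>i. s i \<in> {-L..L}" using s(1) by (auto simp: abs_le_iff minus_le_iff)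
  ultimately obtain \<sigma> q where q: "strict_mono (q::nat \<Rightarrow> nat)" and sl: "(s \<circ> q) \<longlonglongrightarrow> \<sigma>"
    unfolding compact_def by blast
  define w where "w i = h + s (q i) *\<^sub>R e" for i
  have wl: "w \<longlonglongrightarrow> h + \<sigma> *\<^sub>R e"
    unfolding w_def using sl by (intro tendsto_intros) (auto simp: o_def)
  have tq: "(\<lambda>i. t (q i)) \<longlonglongrightarrow> 0"
    using LIMSEQ_subseq_LIMSEQ[OF tlim q] by (simp add: o_def)
  have yl: "(\<lambda>i. x + t (q i) *\<^sub>R w i) \<longlonglongrightarrow> x"
    using tendsto_add[OF tendsto_const[of x] tendsto_scaleR[OF tq wl]] by simp
  have fr: "x + t (q i) *\<^sub>R w i \<in> frontier C" for i using s by (simp add: w_def)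
  have "v \<bullet> (h + \<sigma> *\<^sub>R e) \<le> 0" if v: "outer_normal C x v" for v
  proof -
    have "v \<bullet> w i \<le> 0" for i
    proof -
      have "x + t (q i) *\<^sub>R w i \<in> C" using fr[of i] C(1) frontier_subset_closed by blast
      then have "v \<bullet> (t (q i) *\<^sub>R w i) \<le> 0" using v unfolding outer_normal_def by force
      then show ?thesis using t(1)[of "q i"] by (simp add: mult_le_0_iff)
    qed
    then show ?thesis
      by (intro LIMSEQ_le_const2[OF tendsto_inner[OF tendsto_const wl]]) auto
  qed
  moreover have "D (h + \<sigma> *\<^sub>R e) = 0"
  proof -
    have lin: "bounded_linear D" using f by (rule has_derivative_bounded_linear)
    have fx: "f x = 0" using f0 x U by blast
    have Dl: "(\<lambda>i. D (w i)) \<longlonglongrightarrow> D (h + \<sigma> *\<^sub>R e)"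
      using bounded_linear.tendsto[OF lin wl] .
    have "\<forall>\<^sub>F i in sequentially. x + t (q i) *\<^sub>R w i \<in> U"
      using yl U by (metis topological_tendstoD)
    then have ev0: "\<forall>\<^sub>F i in sequentially. f (x + t (q i) *\<^sub>R w i) = 0"
      by eventually_elim (use f0 fr in blast)
    have "Bseq w" using wl by (rule convergent_imp_Bseq[OF convergentI])
    then obtain K where K: "K > 0" "\<And>i. norm (w i) \<le> K" by (metis BseqE)
    \<comment> \<open>As \<open>f\<close> vanishes at \<open>x\<close> and at the frontier points,
      \<open>D (t (q i) *\<^sub>R w i)\<close> is of smaller order than \<open>t (q i)\<close>; the
      bound \<open>K\<close> on \<open>w\<close> makes the division by \<open>t (q i)\<close>
      uniform.\<close>
    have "(\<lambda>i. D (w i)) \<longlonglongrightarrow> 0"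
      unfolding tendsto_iff
    proof (intro allI impI)
      fix \<epsilon> :: real assume "\<epsilon> > 0"
      then have "\<epsilon> / (2 * K) > 0" using K by simp
      then obtain d where d: "d > 0"
        "\<And>y. norm (y - x) < d \<Longrightarrow> norm (f y - f x - D (y - x)) \<le> \<epsilon> / (2 * K) * norm (y - x)"
        using f unfolding has_derivative_at_alt by blast
      have "\<forall>\<^sub>F i in sequentially. dist (x + t (q i) *\<^sub>R w i) x < d"
        using yl d(1) by (metis tendstoD)
      with ev0 show "\<forall>\<^sub>F i in sequentially. dist (D (w i)) 0 < \<epsilon>"
      proof eventually_elim
        case (elim i)
        have "norm (D (t (q i) *\<^sub>R w i)) \<le> \<epsilon> / (2 * K) * norm (t (q i) *\<^sub>R w i)"
          using d(2)[of "x + t (q i) *\<^sub>R w i"] elim fx by (simp add: dist_norm)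
        then have "t (q i) * norm (D (w i)) \<le> t (q i) * (\<epsilon> / (2 * K) * norm (w i))"
          using t(1)[of "q i"] by (simp add: linear_simps(5)[OF lin] abs_mult mult.left_commute)
        then have "norm (D (w i)) \<le> \<epsilon> / (2 * K) * norm (w i)"
          using t(1)[of "q i"] by (subst (asm) mult_le_cancel_left_pos)
        also have "\<dots> \<le> \<epsilon> / (2 * K) * K"
          using K \<open>\<epsilon> > 0\<close> by (intro mult_left_mono) auto
        also have "\<dots> < \<epsilon>" using K \<open>\<epsilon> > 0\<close> by simp
        finally show ?case by simp
      qed
    qed
    then show ?thesis using Dl LIMSEQ_unique by blast
  qed
  ultimately show thesis using that by (simp add: e_def)
qed

text \<open>The functionals \<open>D\<close> and \<open>v \<bullet> _\<close> are proportional: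
  applying the tangent directions to \<open>h\<close> and \<open>- h\<close> puts the kernel of
  \<open>D\<close> into that of \<open>v\<close>, and neither functional vanishes on the direction
  \<open>e\<close> towards an interior point.\<close>

lemma outer_normal_orthogonal_iff:
  fixes C :: "'a::euclidean_space set"
  assumes C: "closed C" "convex C" "solid C" and x: "x \<in> frontier C"
    and f: "(f has_derivative D) (at x)" and U: "open U" "x \<in> U"
    and f0: "\<And>y. y \<in> frontier C \<inter> U \<Longrightarrow> f y = (0::real)"
    and D: "D a \<noteq> 0" and v: "outer_normal C x v" "v \<noteq> 0"
  shows "v \<bullet> w = 0 \<longleftrightarrow> D w = 0"
proof -
  obtain z where z: "z \<in> interior C" using C(3) unfolding solid_def by auto
  define e where "e = z - x"
  have lin: "bounded_linear D" using f by (rule has_derivative_bounded_linear)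
  note D_simps = linear_simps[OF lin]
  have dir: "\<exists>\<sigma>. D (h + \<sigma> *\<^sub>R e) = 0 \<and> v \<bullet> (h + \<sigma> *\<^sub>R e) \<le> 0" for h
    using frontier_tangent_direction[OF C(1,2) x z f U f0] v(1) unfolding e_def by metis
  \<comment> \<open>Were \<open>D e = 0\<close>, the tangent direction for \<open>a\<close> would
    give \<open>D a = 0\<close>.\<close>
  have De: "D e \<noteq> 0"
    using dir[of a] D by (auto simp: D_simps)
  have ve: "v \<bullet> e < 0"
    unfolding e_def by (rule outer_normal_interior_neg[OF v z])
  \<comment> \<open>For \<open>h\<close> in the kernel of \<open>D\<close>,
    \<open>D e \<noteq> 0\<close> forces \<open>\<sigma> = 0\<close>.\<close>
  have ker_le: "v \<bullet> h \<le> 0" if "D h = 0" for h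
    using dir[of h] that De by (auto simp: D_simps)
  have ker: "v \<bullet> h = 0" if "D h = 0" for h
    using ker_le[of h] ker_le[of "- h"] that by (simp add: D_simps)
  have "v \<bullet> w = (D w / D e) * (v \<bullet> e)"
    using ker[of "w - (D w / D e) *\<^sub>R e"] De by (simp add: D_simps inner_diff_right)
  then show ?thesis using De ve by auto
qed

text \<open>A supporting hyperplane gives existence. All nonzero normals have the kernel of
  \<open>D\<close> as orthogonal complement, so they are parallel, and an interior point fixes their
  sign.\<close>

lemma unique_unit_normal_if_smooth:
  fixes C :: "'a::euclidean_space set"
  assumes C: "closed C" "convex C" "solid C" and x: "x \<in> frontier C"
    and f: "(f has_derivative D) (at x)" and U: "open U" "x \<in> U"
    and f0: "\<And>y. y \<in> frontier C \<inter> U \<Longrightarrow> f y = (0::real)" and D: "D a \<noteq> 0"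
  obtains n where "unique_unit_normal C x n"
proof -
  obtain z where z: "z \<in> interior C" using C(3) unfolding solid_def by auto
  note iff = outer_normal_orthogonal_iff[OF C x f U f0 D]
  have xC: "x \<in> C" and xi: "x \<notin> rel_interior C"
    using x C(1) rel_interior_nonempty_interior[of C] z by (auto simp: frontier_def)
  obtain b where b: "b \<noteq> 0" "\<And>y. y \<in> C \<Longrightarrow> b \<bullet> x \<le> b \<bullet> y"
    using supporting_hyperplane_rel_boundary[OF C(2) xC xi] by metis
  define n where "n = - (b /\<^sub>R norm b)"
  have n: "norm n = 1" "outer_normal C x n"
    using b by (auto simp: n_def outer_normal_def inner_diff_right field_simps)
  have "v = n" if v: "norm v = 1" "outer_normal C x v" for v
  proof -
    have nz: "v \<noteq> 0" "n \<noteq> 0" using v n by auto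
    have vv: "v \<bullet> v = 1" "n \<bullet> n = 1"
      using v n by (auto simp: dot_square_norm)
    define w where "w = v - (n \<bullet> v) *\<^sub>R n"
    have "n \<bullet> w = 0" using vv by (simp add: w_def inner_diff_right)
    then have "v \<bullet> w = 0"
      using iff[OF _ n(2) nz(2), of w] iff[OF _ v(2) nz(1), of w] by simp
    with \<open>n \<bullet> w = 0\<close> have "w \<bullet> w = 0" by (subst (1) w_def) (simp add: inner_diff_left)
    then have vn: "v = (n \<bullet> v) *\<^sub>R n" by (simp add: w_def)
    then have "norm v = \<bar>n \<bullet> v\<bar> * norm n" by (metis norm_scaleR)
    then have "\<bar>n \<bullet> v\<bar> = 1" using v n by simp
    moreover have "v \<bullet> (z - x) = (n \<bullet> v) * (n \<bullet> (z - x))"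
      by (subst vn) simp
    then have "n \<bullet> v > 0"
      using outer_normal_interior_neg[OF v(2) nz(1) z] outer_normal_interior_neg[OF n(2) nz(2) z]
      by (metis mult_less_0_iff less_asym)
    ultimately show ?thesis using vn by simp
  qed
  then show thesis using that n unfolding unique_unit_normal_def by blast
qed

section \<open>The constant of linear regularity\<close>

text \<open>For the upper bound, a move from \<open>y\<close> against \<open>nA + nB\<close> lowers
  both distances at rate about \<open>S / 2\<close> until the point lies in
  \<open>A \<inter> B\<close>. For the lower bound, the points
  \<open>x + t *\<^sub>R (nA + nB)\<close> are about \<open>t * S\<^sup>2 / 2\<close> from either
  set but at least \<open>t * S\<close> from \<open>A \<inter> B\<close>, since
  \<open>nA + nB\<close> is an outer normal of the intersection.\<close>

lemma linear_regularity_of_normals: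
  fixes A B :: "'a::euclidean_space set"
  assumes A: "closed A" "convex A" "x \<in> A" "unique_unit_normal A x nA"
    and B: "closed B" "convex B" "x \<in> B" "unique_unit_normal B x nB"
    and nz: "nA + nB \<noteq> 0"
  shows lin_regular_const_if_gt: "\<And>K. K > 2 / norm (nA + nB) \<Longrightarrow> lin_regular_const A B x K"
    and lin_regular_const_ge: "\<And>K. lin_regular_const A B x K \<Longrightarrow> K \<ge> 2 / norm (nA + nB)"
proof -
  define S where "S = norm (nA + nB)"
  have S: "S > 0" using nz by (simp add: S_def)
  have n1: "nA \<bullet> nA = 1" "nB \<bullet> nB = 1"
    using A B by (auto simp: unique_unit_normal_def dot_square_norm)
  have "S\<^sup>2 = 2 + 2 * (nA \<bullet> nB)"
    using n1 by (simp add: S_def power2_norm_eq_inner inner_add inner_commute)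
  then have nAS: "nA \<bullet> (nA + nB) = S\<^sup>2 / 2" and nBS: "nB \<bullet> (nA + nB) = S\<^sup>2 / 2"
    using n1 by (auto simp: inner_add inner_commute)
  have neA: "A \<noteq> {}" and neB: "B \<noteq> {}" using A B by auto
  have near: "\<exists>\<delta>>0. \<forall>u u'. dist u' x < \<delta> \<longrightarrow>
      infdist u' A \<le> max 0 (infdist u A + nA \<bullet> (u' - u) + e * norm (u' - u)) \<and>
      infdist u' B \<le> max 0 (infdist u B + nB \<bullet> (u' - u) + e * norm (u' - u))"
    if "e > 0" for e
  proof -
    obtain \<delta> where "\<delta> > 0" and \<delta>: "\<And>u. dist u x < \<delta> \<Longrightarrow>
        norm (u - closest_point A u - infdist u A *\<^sub>R nA) \<le> e * infdist u A \<and>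
        norm (u - closest_point B u - infdist u B *\<^sub>R nB) \<le> e * infdist u B"
      using eventually_conj[OF closest_point_residual_near_normal[OF A \<open>e > 0\<close>]
          closest_point_residual_near_normal[OF B \<open>e > 0\<close>]]
      unfolding eventually_nhds_metric by blast
    then show ?thesis
      using infdist_le_linearized[OF A(1,2) neA] infdist_le_linearized[OF B(1,2) neB] by blast
  qed
  show "lin_regular_const A B x K" if "K > 2 / norm (nA + nB)" for K
  proof -
    have K: "K > 0" by (rule less_trans[OF _ that]) (use nz in simp)
    \<comment> \<open>A move of length \<open>K * m\<close> lowers the linearised distance by
      \<open>K * m * S / 2\<close> with error \<open>e * (K * m)\<close>; this \<open>e\<close>
      makes the net decrease exactly \<open>m\<close>.\<close>
    define e where "e = S / 2 - 1 / K"
    have e: "e > 0" using that S K by (simp add: e_def S_def field_simps)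
    obtain \<delta> where \<delta>: "\<delta> > 0" and
      nr: "\<And>u u'. dist u' x < \<delta> \<Longrightarrow>
      infdist u' A \<le> max 0 (infdist u A + nA \<bullet> (u' - u) + e * norm (u' - u)) \<and>
      infdist u' B \<le> max 0 (infdist u B + nB \<bullet> (u' - u) + e * norm (u' - u))"
      using near[OF e] by blast
    define \<delta>' where "\<delta>' = \<delta> / (2 * (1 + K))"
    have \<delta>': "\<delta>' > 0" "(1 + K) * \<delta>' < \<delta>"
    proof -
      show "\<delta>' > 0" using \<delta> K by (simp add: \<delta>'_def)
      have "(1 + K) * \<delta>' = \<delta> / 2" using K by (simp add: \<delta>'_def field_simps)
      then show "(1 + K) * \<delta>' < \<delta>" using \<delta> by simp
    qed
    have "infdist y (A \<inter> B) \<le> K * max (infdist y A) (infdist y B)" if y: "y \<in> cball x \<delta>'" for y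
    proof -
      define m where "m = max (infdist y A) (infdist y B)"
      have m0: "m \<ge> 0" by (simp add: m_def infdist_nonneg le_max_iff_disj)
      have mle: "m \<le> dist y x" using infdist_le[OF A(3), of y] infdist_le[OF B(3), of y]
        by (simp add: m_def)
      define r where "r = - (K * m / S) *\<^sub>R (nA + nB)"
      have nr_r: "norm r = K * m" using S K m0 by (simp add: r_def S_def[symmetric])
      have "dist (y + r) x \<le> dist y x + norm r"
        by (metis add.commute add_diff_eq dist_norm norm_triangle_ineq)
      also have "\<dots> \<le> (1 + K) * \<delta>'"
      proof -
        have "dist y x \<le> \<delta>'" using y by (simp add: dist_commute)
        moreover have "K * m \<le> K * dist y x" using mle K by simp
        moreover have "K * dist y x \<le> K * \<delta>'" using \<open>dist y x \<le> \<delta>'\<close> K by simp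
        ultimately show ?thesis by (simp add: nr_r algebra_simps)
      qed
      finally have near_r: "dist (y + r) x < \<delta>" using \<delta>' by linarith
      have "nA \<bullet> r = - (K * m * S / 2)" "nB \<bullet> r = - (K * m * S / 2)"
        using S nAS nBS by (simp_all only: r_def inner_scaleR_right) (simp_all add: power2_eq_square)
      moreover have "e * (K * m) = K * m * S / 2 - m"
        using K by (simp add: e_def field_simps)
      ultimately have "infdist y A + nA \<bullet> (y + r - y) + e * norm (y + r - y) \<le> 0"
        "infdist y B + nB \<bullet> (y + r - y) + e * norm (y + r - y) \<le> 0"
        by (auto simp: nr_r m_def)
      then have "infdist (y + r) A = 0" "infdist (y + r) B = 0"
        using nr[OF near_r, of y] infdist_nonneg[of "y + r"] by (auto intro: antisym)
      then have "y + r \<in> A \<inter> B"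
        using A(1) B(1) neA neB by (simp add: in_closed_iff_infdist_zero)
      then have "infdist y (A \<inter> B) \<le> dist y (y + r)" by (rule infdist_le)
      then show ?thesis by (simp add: nr_r dist_norm m_def)
    qed
    then show ?thesis using K \<delta>' unfolding lin_regular_const_def by blast
  qed
  show "K \<ge> 2 / norm (nA + nB)" if lr: "lin_regular_const A B x K" for K
  proof -
    obtain \<delta> where K: "K > 0" and \<delta>: "\<delta> > 0" and
      reg: "\<And>y. y \<in> cball x \<delta> \<Longrightarrow> infdist y (A \<inter> B) \<le> K * max (infdist y A) (infdist y B)"
      using lr unfolding lin_regular_const_def by blast
    \<comment> \<open>The error is taken as \<open>e / K\<close> because the regularity inequality
      multiplies it by \<open>K\<close>.\<close>
    have *: "1 \<le> K * (S / 2) + e" if e': "e > 0" for e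
    proof -
      have "e / K > 0" using e' K by simp
      from near[OF this] obtain \<delta>2 where \<delta>2: "\<delta>2 > 0" and
        nr: "\<And>u u'. dist u' x < \<delta>2 \<Longrightarrow>
        infdist u' A \<le> max 0 (infdist u A + nA \<bullet> (u' - u) + e / K * norm (u' - u)) \<and>
        infdist u' B \<le> max 0 (infdist u B + nB \<bullet> (u' - u) + e / K * norm (u' - u))"
        by blast
      define t where "t = min \<delta> (\<delta>2 / 2) / S"
      have t: "t > 0" "t * S \<le> \<delta>" "t * S < \<delta>2"
        using \<delta> \<delta>2 S by (auto simp: t_def)
      define y where "y = x + t *\<^sub>R (nA + nB)"
      have dyx: "dist y x = t * S" using t by (simp add: y_def dist_norm S_def)
      define Q where "Q = t * S * (S / 2 + e / K)"
      have Q: "Q \<ge> 0" using t S K e' by (simp add: Q_def)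
      have "infdist y A \<le> Q" "infdist y B \<le> Q"
      proof -
        have "nA \<bullet> (y - x) = t * (S\<^sup>2 / 2)" "nB \<bullet> (y - x) = t * (S\<^sup>2 / 2)"
          using nAS nBS by (simp_all add: y_def)
        moreover have "t * (S\<^sup>2 / 2) + e / K * (t * S) = Q"
          by (simp add: Q_def power2_eq_square algebra_simps)
        ultimately show "infdist y A \<le> Q" "infdist y B \<le> Q"
          using nr[of y x] t(3) A(3) B(3) dyx Q by (simp_all add: dist_norm)
      qed
      then have "infdist y (A \<inter> B) \<le> K * Q"
        using reg[of y] t K dyx by (smt (verit) dist_commute max.bounded_iff mem_cball mult_left_mono)
      moreover have "t * S \<le> infdist y (A \<inter> B)"
      proof -
        have "outer_normal (A \<inter> B) x (nA + nB)"
          using A(4) B(4) by (auto simp: unique_unit_normal_def outer_normal_def inner_add_left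
              intro!: add_nonpos_nonpos)
        moreover have "A \<inter> B \<noteq> {}" using A(3) B(3) by blast
        moreover have "(nA + nB) \<bullet> (y - x) = S * (t * S)"
          using power2_norm_eq_inner[of "nA + nB"] by (simp add: y_def S_def power2_eq_square)
        ultimately have "S * (t * S) \<le> S * infdist y (A \<inter> B)"
          using inner_le_infdist_if_outer_normal unfolding S_def by metis
        then show ?thesis using S by simp
      qed
      ultimately have "t * S * 1 \<le> t * S * (K * (S / 2) + e)"
        using K by (simp add: Q_def algebra_simps)
      then show ?thesis using t S by (subst (asm) mult_le_cancel_left_pos) auto
    qed
    have "1 \<le> K * (S / 2)" using * by (rule field_le_epsilon)
    then show ?thesis using S by (simp add: S_def[symmetric] field_simps)
  qed
qed

text \<open>Every value above the bound is a regularity constant, which by density gives one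
  inequality; the value with \<open>+ 1\<close> shows that the set is nonempty.\<close>

lemma Inf_lin_regular_const_eq:
  fixes A B :: "'a::euclidean_space set"
  assumes A: "closed A" "convex A" "x \<in> A" "unique_unit_normal A x nA"
    and B: "closed B" "convex B" "x \<in> B" "unique_unit_normal B x nB"
    and nz: "nA + nB \<noteq> 0"
  shows "Inf {K. lin_regular_const A B x K} = 2 / norm (nA + nB)"
proof (rule antisym)
  let ?L = "{K. lin_regular_const A B x K}"
  have bdd: "bdd_below ?L" by (rule bdd_belowI) (use lin_regular_const_ge[OF assms] in blast)
  show "Inf ?L \<le> 2 / norm (nA + nB)"
    by (rule dense_ge) (use lin_regular_const_if_gt[OF assms] bdd in \<open>auto intro: cInf_lower\<close>)
  show "2 / norm (nA + nB) \<le> Inf ?L"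
    using lin_regular_const_ge[OF assms]
      lin_regular_const_if_gt[OF assms, of "2 / norm (nA + nB) + 1"]
    by (intro cInf_greatest) auto
qed

section \<open>Geometric decay\<close>

text \<open>The differences \<open>z (j+1) - \<rho> * z j\<close> satisfy a perturbed linear recursion only as long as
  the maximum is not attained at \<open>0\<close>; bounding the ratios \<open>z (j+1) / z j\<close> from above instead
  avoids the distinction: the map \<open>R \<mapsto> 2 * \<rho> - \<rho>\<^sup>2 / R\<close> is increasing, and it decreases every
  \<open>R > \<rho>\<close>.\<close>

lemma double_root_recursion_bound:
  fixes z :: "nat \<Rightarrow> real"
  assumes z0: "\<And>j. z j \<ge> 0" and \<rho>: "0 \<le> \<rho>" "\<rho> < \<mu>"
    and rec: "\<And>e. e > 0 \<Longrightarrow>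
      \<forall>\<^sub>F j in sequentially. z (j + 2) \<le> max 0 ((2 * \<rho> + e) * z (j + 1) - \<rho>\<^sup>2 * (1 - e) * z j)"
  obtains C where "C > 0" "\<And>j. z j \<le> C * \<mu> ^ j"
proof -
  \<comment> \<open>An upper bound for the first ratio, where \<open>2 * \<rho> + e\<close> is at
    most \<open>2 * \<rho> + 1\<close>.\<close>
  define R0 where "R0 = max \<mu> (2 * \<rho> + 1)"
  \<comment> \<open>For \<open>R\<close> between \<open>\<mu>\<close> and \<open>R0\<close> the
    unperturbed map lowers \<open>R\<close> by \<open>(R - \<rho>)\<^sup>2 / R\<close>, which is at
    least \<open>(\<mu> - \<rho>)\<^sup>2 / R0\<close>. Half of this is \<open>\<tau>\<close>; the
    other half absorbs the errors and dictates \<open>e\<close>.\<close>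
  define \<tau> where "\<tau> = (\<mu> - \<rho>)\<^sup>2 / (2 * R0)"
  define e where "e = min 1 ((\<mu> - \<rho>)\<^sup>2 / (2 * (R0 + \<rho>\<^sup>2)))"
  have R0: "R0 > 0" "\<mu> \<le> R0" using \<rho> by (auto simp: R0_def)
  have \<mu>: "\<mu> > 0" using \<rho> by simp
  have \<tau>: "\<tau> > 0" using R0 \<rho> by (simp add: \<tau>_def)
  have R0\<rho>: "R0 + \<rho>\<^sup>2 > 0" using R0(1) by (simp add: add_pos_nonneg)
  have e: "e > 0" "e \<le> 1" "e * (R0 + \<rho>\<^sup>2) \<le> (\<mu> - \<rho>)\<^sup>2 / 2"
  proof -
    show "e > 0" "e \<le> 1" using R0\<rho> \<rho> by (auto simp: e_def)
    have "e * (R0 + \<rho>\<^sup>2) \<le> (\<mu> - \<rho>)\<^sup>2 / (2 * (R0 + \<rho>\<^sup>2)) * (R0 + \<rho>\<^sup>2)"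
      using R0\<rho> by (intro mult_right_mono) (auto simp: e_def)
    also have "\<dots> = (\<mu> - \<rho>)\<^sup>2 / 2" using R0\<rho> by (simp add: field_simps)
    finally show "e * (R0 + \<rho>\<^sup>2) \<le> (\<mu> - \<rho>)\<^sup>2 / 2" .
  qed
  obtain J where J: "\<And>j. j \<ge> J \<Longrightarrow>
      z (j + 2) \<le> max 0 ((2 * \<rho> + e) * z (j + 1) - \<rho>\<^sup>2 * (1 - e) * z j)"
    using rec[OF e(1)] by (auto simp: eventually_sequentially)
  have contract: "2 * \<rho> + e - \<rho>\<^sup>2 * (1 - e) / R \<le> R - \<tau>" if R: "\<mu> \<le> R" "R \<le> R0" for R
  proof -
    have Rp: "R > 0" using R \<mu> by simp
    have "e * R + e * \<rho>\<^sup>2 \<le> e * (R0 + \<rho>\<^sup>2)" using R e by (simp add: algebra_simps)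
    moreover have "(\<mu> - \<rho>)\<^sup>2 \<le> (R - \<rho>)\<^sup>2" using R \<rho> by (intro power_mono) auto
    moreover have "\<tau> * R \<le> (\<mu> - \<rho>)\<^sup>2 / 2"
      using R \<tau> R0 mult_left_mono[OF R(2), of \<tau>] by (simp add: \<tau>_def)
    ultimately have "e * R + e * \<rho>\<^sup>2 + \<tau> * R \<le> (R - \<rho>)\<^sup>2" using e by linarith
    then have "(2 * \<rho> + e) * R - \<rho>\<^sup>2 * (1 - e) \<le> (R - \<tau>) * R"
      by (simp add: power2_eq_square algebra_simps)
    then show ?thesis using Rp by (simp add: field_simps)
  qed
  have \<rho>e: "0 \<le> \<rho>\<^sup>2 * (1 - e)" using e by simp
  \<comment> \<open>The ratio bound is kept in product form since \<open>z\<close> may vanish. It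
    starts at index \<open>J + 1\<close>: the first use of the recursion drops the subtracted term,
    as no earlier ratio is known.\<close>
  have ratio: "z (J + i + 2) \<le> max \<mu> (R0 - real i * \<tau>) * z (J + i + 1)" for i
  proof (induction i)
    case 0
    have "z (J + 2) \<le> max 0 ((2 * \<rho> + e) * z (J + 1) - \<rho>\<^sup>2 * (1 - e) * z J)" using J by simp
    also have "\<dots> \<le> (2 * \<rho> + e) * z (J + 1)"
      using \<rho>e z0[of J] z0[of "J + 1"] \<rho> e by (simp add: mult_nonneg_nonneg)
    also have "\<dots> \<le> R0 * z (J + 1)"
      using e by (intro mult_right_mono z0) (auto simp: R0_def)
    also have "\<dots> = max \<mu> R0 * z (J + 1)" using R0 by (simp add: max_def)
    finally show ?case by simp
  next
    case (Suc i)
    define R where "R = max \<mu> (R0 - real i * \<tau>)"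
    define p where "p = J + i + 1"
    have R: "\<mu> \<le> R" "R \<le> R0" using R0 \<tau> by (auto simp: R_def)
    have Rp: "R > 0" using R \<mu> by simp
    have IH: "z (p + 1) \<le> R * z p" using Suc by (simp add: R_def p_def)
    have "\<rho>\<^sup>2 * (1 - e) / R * z (p + 1) \<le> \<rho>\<^sup>2 * (1 - e) / R * (R * z p)"
      using \<rho>e Rp IH by (intro mult_left_mono) auto
    then have "\<rho>\<^sup>2 * (1 - e) / R * z (p + 1) \<le> \<rho>\<^sup>2 * (1 - e) * z p" using Rp by simp
    moreover have "z (p + 2) \<le> max 0 ((2 * \<rho> + e) * z (p + 1) - \<rho>\<^sup>2 * (1 - e) * z p)"
      by (rule J) (simp add: p_def)
    ultimately have "z (p + 2) \<le> max 0 ((2 * \<rho> + e - \<rho>\<^sup>2 * (1 - e) / R) * z (p + 1))"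
      by (auto simp: left_diff_distrib max_def split: if_splits)
    also have "\<dots> \<le> max \<mu> (R0 - real (Suc i) * \<tau>) * z (p + 1)"
    proof -
      have "R - \<tau> \<le> max \<mu> (R0 - real (Suc i) * \<tau>)"
        using \<tau> by (auto simp: R_def max_def algebra_simps)
      then have "2 * \<rho> + e - \<rho>\<^sup>2 * (1 - e) / R \<le> max \<mu> (R0 - real (Suc i) * \<tau>)"
        using contract[OF R] by linarith
      then have "(2 * \<rho> + e - \<rho>\<^sup>2 * (1 - e) / R) * z (p + 1) \<le> max \<mu> (R0 - real (Suc i) * \<tau>) * z (p + 1)"
        using z0 by (rule mult_right_mono)
      moreover have "0 \<le> max \<mu> (R0 - real (Suc i) * \<tau>) * z (p + 1)"
        using \<mu> z0 by (simp add: le_max_iff_disj)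
      ultimately show ?thesis by simp
    qed
    finally show ?case by (simp add: p_def)
  qed
  obtain N where N: "R0 < real N * \<tau>" using \<tau> reals_Archimedean3 by blast
  define J' where "J' = J + N + 1"
  have step: "z (Suc j) \<le> \<mu> * z j" if "j \<ge> J'" for j
  proof -
    define i where "i = j - J - 1"
    have i: "j = J + i + 1" "i \<ge> N" using that by (auto simp: J'_def i_def)
    have "R0 - real i * \<tau> \<le> \<mu>"
      using N i(2) \<tau> mult_right_mono[of "real N" "real i" \<tau>] \<mu> by linarith
    then show ?thesis using ratio[of i] i by (simp add: max_absorb1)
  qed
  \<comment> \<open>The sum covers the finitely many terms before the decay sets in; the summand
    \<open>1\<close> keeps \<open>C\<close> positive.\<close>
  define C where "C = 1 + (\<Sum>j\<le>J'. z j / \<mu> ^ j)"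
  have sum0: "0 \<le> (\<Sum>j\<le>J'. z j / \<mu> ^ j)" using z0 \<mu> by (intro sum_nonneg) auto
  have head: "z j \<le> C * \<mu> ^ j" if "j \<le> J'" for j
  proof -
    have "z j / \<mu> ^ j \<le> (\<Sum>j\<le>J'. z j / \<mu> ^ j)"
      using z0 \<mu> that by (intro member_le_sum) auto
    then have "z j / \<mu> ^ j \<le> C" by (simp add: C_def)
    then show ?thesis using \<mu> by (simp add: field_simps)
  qed
  have "z j \<le> C * \<mu> ^ j" for j
  proof (cases "j \<le> J'")
    case False
    then have "J' \<le> j" by simp
    then show ?thesis
    proof (induction rule: dec_induct)
      case (step n)
      have "z (Suc n) \<le> \<mu> * z n" by (rule \<open>\<And>j. J' \<le> j \<Longrightarrow> z (Suc j) \<le> \<mu> * z j\<close>) (rule step)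
      also have "\<dots> \<le> \<mu> * (C * \<mu> ^ n)" using step \<mu> by (intro mult_left_mono) auto
      finally show ?case by (simp add: mult.left_commute)
    qed (simp add: head)
  qed (rule head)
  then show thesis using that[of C] sum0 by (simp add: C_def)
qed

text \<open>Telescoping bounds the distance from \<open>x k\<close> to later iterates by a geometric
  sum, and the limit inherits the bound.\<close>

lemma R_linear_conv_if_steps_geometric:
  fixes x :: "nat \<Rightarrow> 'a::real_normed_vector"
  assumes step: "\<And>k. norm (x (Suc k) - x k) \<le> C * \<mu> ^ k" and C: "C > 0"
    and \<mu>: "0 < \<mu>" "\<mu> < 1" and lim: "x \<longlonglongrightarrow> L"
  shows "R_linear_conv x L \<mu>"
proof -
  have part: "norm (x (k + m) - x k) \<le> C * \<mu> ^ k * (1 - \<mu> ^ m) / (1 - \<mu>)" for k m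
  proof (induction m)
    case (Suc m)
    have "norm (x (k + Suc m) - x k) \<le> norm (x (Suc (k + m)) - x (k + m)) + norm (x (k + m) - x k)"
      using norm_triangle_ineq[of "x (Suc (k + m)) - x (k + m)" "x (k + m) - x k"] by simp
    also have "\<dots> \<le> C * \<mu> ^ (k + m) + C * \<mu> ^ k * (1 - \<mu> ^ m) / (1 - \<mu>)"
      using step[of "k + m"] Suc by (rule add_mono)
    also have "\<dots> = C * \<mu> ^ k * (1 - \<mu> ^ Suc m) / (1 - \<mu>)"
      using \<mu> by (simp add: field_simps power_add)
    finally show ?case .
  qed simp
  have "norm (L - x k) \<le> C / (1 - \<mu>) * \<mu> ^ k" for k
  proof (rule LIMSEQ_le_const2)
    show "(\<lambda>m. norm (x (k + m) - x k)) \<longlonglongrightarrow> norm (L - x k)"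
      using LIMSEQ_ignore_initial_segment[OF lim, of k]
      by (intro tendsto_intros) (simp add: add.commute)
    have "C * \<mu> ^ k * (1 - \<mu> ^ m) / (1 - \<mu>) \<le> C / (1 - \<mu>) * \<mu> ^ k" for m
    proof -
      have "C * \<mu> ^ k * (1 - \<mu> ^ m) \<le> C * \<mu> ^ k * 1"
        using C \<mu> by (intro mult_left_mono) auto
      then show ?thesis using \<mu> by (simp add: divide_right_mono)
    qed
    then show "\<exists>N. \<forall>m\<ge>N. norm (x (k + m) - x k) \<le> C / (1 - \<mu>) * \<mu> ^ k"
      using part order_trans by blast
  qed
  then show ?thesis
    using C \<mu> unfolding R_linear_conv_def
    by (intro exI[of _ "C / (1 - \<mu>)"]) (auto simp: norm_minus_commute)
qed

section \<open>Tangent spaces of the frontiers\<close>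

lemma manifold_chart_has_derivative:
  assumes "manifold_chart k M x U d F" "2 \<le> k" "j < d" "y \<in> U"
  shows "((\<lambda>z. F z j) has_derivative frechet_derivative (\<lambda>z. F z j) (at y)) (at y)"
proof -
  obtain k' where "k = Suc k'" using assms(2) by (cases k) auto
  then show ?thesis
    using assms unfolding manifold_chart_def by (auto simp: frechet_derivative_works[symmetric])
qed

text \<open>The chart obtained is the very one that \<open>SOME\<close> picks in
  \<open>tangent_space\<close>, so both facts concern the same chart.\<close>

lemma tangent_space_chartE:
  assumes "Ck_manifold_around k M x"
  obtains U d F where "manifold_chart k M x U d F"
    "tangent_space k M x = {v. \<forall>j<d. frechet_derivative (\<lambda>z. F z j) (at x) v = 0}"
proof -
  let ?P = "\<lambda>(U, d, F). manifold_chart k M x U d F"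
  obtain U d F where eq: "(SOME p. ?P p) = (U, d, F)" by (metis prod_cases3)
  have "\<exists>p. ?P p" using assms unfolding Ck_manifold_around_def by auto
  then have "?P (SOME p. ?P p)" by (rule someI_ex)
  then show thesis using that[of U d F] by (simp add: tangent_space_def eq)
qed

text \<open>Each component of the chart vanishes on the frontier and has a nonzero derivative at
  \<open>x\<close>, so each derivative has the orthogonal complement of \<open>n\<close> as its
  kernel.\<close>

lemma tangent_space_frontier_convex:
  fixes C :: "'a::euclidean_space set"
  assumes C: "closed C" "convex C" "solid C" and x: "x \<in> frontier C"
    and k: "2 \<le> k" "Ck_manifold_around k (frontier C) x"
  obtains n where "unique_unit_normal C x n" "tangent_space k (frontier C) x = {v. n \<bullet> v = 0}"
proof -
  obtain U d F where ch: "manifold_chart k (frontier C) x U d F"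
    and T: "tangent_space k (frontier C) x = {v. \<forall>j<d. frechet_derivative (\<lambda>z. F z j) (at x) v = 0}"
    using tangent_space_chartE[OF k(2)] .
  have U: "open U" "x \<in> U" and M: "frontier C \<inter> U = {y \<in> U. \<forall>j<d. F y j = 0}"
    using ch unfolding manifold_chart_def by auto
  \<comment> \<open>Without equations the frontier would fill \<open>U\<close>, and \<open>x\<close>
    would be interior to \<open>C\<close>.\<close>
  have "d \<noteq> 0"
  proof
    assume "d = 0"
    then have "U \<subseteq> C" using M C(1) frontier_subset_closed by blast
    then have "x \<in> interior C" using U by (meson interior_maximal subsetD)
    then show False using x by (simp add: frontier_def)
  qed
  have D: "((\<lambda>z. F z j) has_derivative frechet_derivative (\<lambda>z. F z j) (at x)) (at x)"
    and F0: "\<And>y. y \<in> frontier C \<inter> U \<Longrightarrow> F y j = 0"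
    and nz: "\<exists>a. frechet_derivative (\<lambda>z. F z j) (at x) a \<noteq> 0" if "j < d" for j
  proof -
    show "((\<lambda>z. F z j) has_derivative frechet_derivative (\<lambda>z. F z j) (at x)) (at x)"
      using manifold_chart_has_derivative[OF ch k(1) that U(2)] .
    show "\<And>y. y \<in> frontier C \<inter> U \<Longrightarrow> F y j = 0" using M that by blast
    have "\<exists>v. \<forall>i<d. frechet_derivative (\<lambda>z. F z i) (at x) v = 1"
      using ch U(2) unfolding manifold_chart_def by auto
    then show "\<exists>a. frechet_derivative (\<lambda>z. F z j) (at x) a \<noteq> 0"
      using that by (metis zero_neq_one)
  qed
  obtain n where n: "unique_unit_normal C x n"
    using unique_unit_normal_if_smooth[OF C x D U F0] nz \<open>d \<noteq> 0\<close> by (metis gr0I)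
  then have n': "outer_normal C x n" "n \<noteq> 0" unfolding unique_unit_normal_def by auto
  have "n \<bullet> v = 0 \<longleftrightarrow> frechet_derivative (\<lambda>z. F z j) (at x) v = 0" if "j < d" for j v
  proof -
    obtain a where "frechet_derivative (\<lambda>z. F z j) (at x) a \<noteq> 0" using nz[OF \<open>j < d\<close>] by blast
    then show ?thesis
      using outer_normal_orthogonal_iff[OF C x D[OF \<open>j < d\<close>] U F0[OF \<open>j < d\<close>] _ n'] by blast
  qed
  then have "tangent_space k (frontier C) x = {v. n \<bullet> v = 0}"
    using T \<open>d \<noteq> 0\<close> by fast
  then show thesis using that n by blast
qed

text \<open>If the normals are opposite, then the tangent hyperplane \<open>H\<close> of both frontiers contains
  \<open>A \<inter> B\<close>. The regularity assumption makes the intersection of the frontiers a hypersurface with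
  tangent space \<open>H\<close>, so by the intermediate value theorem it contains a neighbourhood of \<open>x\<close>
  in \<open>H\<close>.\<close>

lemma lin_regular_const_opposite_normals:
  fixes A B :: "'a::euclidean_space set"
  assumes A: "closed A" and B: "closed B" and fr: "x \<in> frontier A" "x \<in> frontier B"
    and nA: "outer_normal A x n" and nB: "outer_normal B x (- n)" and n: "norm n = 1"
    and k: "2 \<le> k" "Ck_manifold_around k (frontier A \<inter> frontier B) x"
    and T: "tangent_space k (frontier A \<inter> frontier B) x = {v. n \<bullet> v = 0}"
  shows "lin_regular_const A B x 1"
proof -
  obtain U d F where ch: "manifold_chart k (frontier A \<inter> frontier B) x U d F"
    and Td: "{v. n \<bullet> v = 0} = {v. \<forall>j<d. frechet_derivative (\<lambda>z. F z j) (at x) v = 0}"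
    using tangent_space_chartE[OF k(2)] unfolding T .
  have U: "open U" "x \<in> U"
    and M: "frontier A \<inter> frontier B \<inter> U = {y \<in> U. \<forall>j<d. F y j = 0}"
    and surj: "\<And>c. \<exists>v. \<forall>j<d. frechet_derivative (\<lambda>z. F z j) (at x) v = c j"
    using ch unfolding manifold_chart_def by auto
  have x: "x \<in> A" "x \<in> B" using fr A B frontier_subset_closed by blast+
  have nn: "n \<bullet> n = 1" using n by (simp add: dot_square_norm)
  define D where "D j = frechet_derivative (\<lambda>z. F z j) (at x)" for j
  have D: "((\<lambda>z. F z j) has_derivative D j) (at x)" if "j < d" for j
    unfolding D_def by (rule manifold_chart_has_derivative[OF ch k(1) that U(2)])
  have Dv: "D j v = (n \<bullet> v) * D j n" if "j < d" for j v
  proof -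
    have "n \<bullet> (v - (n \<bullet> v) *\<^sub>R n) = 0" by (simp add: inner_diff_right nn)
    then have "D j (v - (n \<bullet> v) *\<^sub>R n) = 0" using Td that by (auto simp: D_def set_eq_iff)
    then show ?thesis
      using linear_simps[OF has_derivative_bounded_linear[OF D[OF that]]] by simp
  qed
  \<comment> \<open>All derivatives \<open>D j\<close> are multiples of
    \<open>n \<bullet> _\<close>, so at most one equation is compatible with surjectivity; with
    none, \<open>n\<close> itself would be tangent.\<close>
  have d1: "d = 1"
  proof (rule ccontr)
    assume "d \<noteq> 1"
    have "d \<noteq> 0"
    proof
      assume "d = 0"
      then have "n \<in> {v. n \<bullet> v = 0}" unfolding Td by simp
      then show False using nn by simp
    qed
    with \<open>d \<noteq> 1\<close> have d: "0 < d" "1 < d" by auto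
    obtain v where v: "\<And>j. j < d \<Longrightarrow> D j v = (if j = 0 then 1 else 0)"
      using surj[of "\<lambda>j. if j = 0 then 1 else 0"] unfolding D_def by blast
    obtain w where w: "\<And>j. j < d \<Longrightarrow> D j w = 1"
      using surj[of "\<lambda>j. 1"] unfolding D_def by blast
    show False
      using v[OF d(1)] v[OF d(2)] w[OF d(2)] Dv[OF d(1), of v] Dv[OF d(2), of v] Dv[OF d(2), of w]
      by auto
  qed
  define l where "l = D 0 n"
  have l: "l \<noteq> 0"
  proof
    assume "l = 0"
    moreover obtain w where "D 0 w = 1" using surj[of "\<lambda>j. 1"] d1 unfolding D_def by auto
    ultimately show False using Dv[of 0 w] d1 by (simp add: l_def)
  qed
  \<comment> \<open>The factor \<open>l\<close> makes the derivative along \<open>n\<close> equal to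
    \<open>l * l\<close>, so \<open>H\<close> increases through \<open>x\<close> in this
    direction.\<close>
  define H where "H y = F y 0 * l" for y
  have H0: "H y = 0 \<longleftrightarrow> y \<in> frontier A \<inter> frontier B" if "y \<in> U" for y
    using M that d1 l by (auto simp: H_def set_eq_iff)
  have Hc: "continuous_on U H"
    unfolding H_def using manifold_chart_has_derivative[OF ch k(1)] d1
    by (intro continuous_intros continuous_at_imp_continuous_on ballI)
      (auto intro: has_derivative_continuous)
  have "((\<lambda>t. H (x + t *\<^sub>R n)) has_derivative (\<lambda>t. D 0 (t *\<^sub>R n) * l)) (at 0)"
  proof -
    have "((\<lambda>z. F z 0) has_derivative D 0) (at (x + 0 *\<^sub>R n))" using D d1 by simp
    then have "((\<lambda>t. F (x + t *\<^sub>R n) 0) has_derivative (\<lambda>t. D 0 (t *\<^sub>R n))) (at 0)"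
      by (rule has_derivative_compose[rotated]) (auto intro!: derivative_eq_intros)
    then show ?thesis unfolding H_def by (intro has_derivative_mult_left)
  qed
  moreover have "(\<lambda>t. D 0 (t *\<^sub>R n) * l) = (\<lambda>t. (l * l) * t)"
    using linear_simps(5)[OF has_derivative_bounded_linear[OF D[of 0]]] d1 by (auto simp: l_def)
  ultimately have der: "((\<lambda>t. H (x + t *\<^sub>R n)) has_real_derivative (l * l)) (at 0)"
    by (simp add: has_field_derivative_def)
  have ll: "l * l > 0" using l by (metis not_real_square_gt_zero)
  have Hx: "H x = 0" using H0[OF U(2)] fr by simp
  obtain d1 where d1: "d1 > 0" "\<And>h. 0 < h \<Longrightarrow> h < d1 \<Longrightarrow> H (x + h *\<^sub>R n) > 0"
    using DERIV_pos_inc_right[OF der ll] Hx by auto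
  obtain d2 where d2: "d2 > 0" "\<And>h. 0 < h \<Longrightarrow> h < d2 \<Longrightarrow> H (x - h *\<^sub>R n) < 0"
    using DERIV_pos_inc_left[OF der ll] Hx by auto
  obtain r where r: "r > 0" "ball x r \<subseteq> U" using U by (auto simp: open_contains_ball)
  define \<tau> where "\<tau> = min (min d1 d2) r / 2"
  have \<tau>: "\<tau> > 0" "\<tau> < d1" "\<tau> < d2" "\<tau> \<le> r / 2" using d1(1) d2(1) r(1) by (auto simp: \<tau>_def)
  have inU: "y + t *\<^sub>R n \<in> U" if "dist y x < r / 2" "\<bar>t\<bar> \<le> \<tau>" for y t
  proof -
    have "dist (y + t *\<^sub>R n) x \<le> dist y x + norm (t *\<^sub>R n)"
      by (metis add.commute add_diff_eq dist_norm norm_triangle_ineq)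
    then have "dist (y + t *\<^sub>R n) x < r" using that n \<tau> by simp
    then show ?thesis using r(2) by (auto simp: dist_commute)
  qed
  have cont: "((\<lambda>y. H (y + t *\<^sub>R n)) \<longlongrightarrow> H (x + t *\<^sub>R n)) (nhds x)" if "\<bar>t\<bar> \<le> \<tau>" for t
  proof -
    have "isCont H (x + t *\<^sub>R n)"
      using Hc U(1) inU[of x t] that r(1) by (simp add: continuous_on_eq_continuous_at)
    then show ?thesis
      by (rule isCont_tendsto_compose) (intro tendsto_intros filterlim_ident)
  qed
  have "\<forall>\<^sub>F y in nhds x. H (y + \<tau> *\<^sub>R n) > 0"
    using cont[of \<tau>] d1(2)[of \<tau>] \<tau>
    by (auto intro: order_tendstoD(1))
  moreover have "\<forall>\<^sub>F y in nhds x. H (y + (- \<tau>) *\<^sub>R n) < 0"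
    using cont[of "-\<tau>"] d2(2)[of \<tau>] \<tau>
    by (auto intro: order_tendstoD(2))
  moreover have "\<forall>\<^sub>F y in nhds x. dist y x < r / 2"
    using r(1) unfolding eventually_nhds_metric by (intro exI[of _ "r/2"]) auto
  ultimately have "\<forall>\<^sub>F y in nhds x. H (y + \<tau> *\<^sub>R n) > 0 \<and> H (y + (- \<tau>) *\<^sub>R n) < 0 \<and> dist y x < r / 2"
    by eventually_elim auto
  then obtain \<delta> where \<delta>: "\<delta> > 0" and nr: "\<And>y. dist y x < \<delta> \<Longrightarrow>
      H (y + \<tau> *\<^sub>R n) > 0 \<and> H (y + (- \<tau>) *\<^sub>R n) < 0 \<and> dist y x < r / 2"
    unfolding eventually_nhds_metric by blast
  \<comment> \<open>The sign change of \<open>H\<close> along \<open>n\<close> yields a point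
    \<open>y + t *\<^sub>R n\<close> on both frontiers. Membership in \<open>A\<close> forces
    \<open>t \<le> 0\<close> and membership in \<open>B\<close> forces
    \<open>t \<ge> 0\<close>.\<close>
  have plane: "y \<in> A \<inter> B" if y: "n \<bullet> (y - x) = 0" "dist y x < \<delta>" for y
  proof -
    have "continuous_on {-\<tau>..\<tau>} (\<lambda>t. H (y + t *\<^sub>R n))"
      using nr[OF y(2)] inU by (intro continuous_on_compose2[OF Hc] continuous_intros) auto
    then obtain t where t: "-\<tau> \<le> t" "t \<le> \<tau>" "H (y + t *\<^sub>R n) = 0"
      using IVT'[of "\<lambda>t. H (y + t *\<^sub>R n)" "-\<tau>" 0 \<tau>] nr[OF y(2)] \<tau>(1) by auto
    have "y + t *\<^sub>R n \<in> frontier A \<inter> frontier B"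
      using H0[OF inU] nr[OF y(2)] t by auto
    then have AB: "y + t *\<^sub>R n \<in> A" "y + t *\<^sub>R n \<in> B"
      using A B frontier_subset_closed by blast+
    have "n \<bullet> (y + t *\<^sub>R n - x) = t" using y(1) nn by (simp add: inner_diff_right inner_add_right)
    then have "t = 0" using AB nA nB unfolding outer_normal_def by fastforce
    then show ?thesis using AB by simp
  qed
  \<comment> \<open>The foot \<open>h\<close> of \<open>y\<close> on the tangent hyperplane is at
    most \<open>2 * \<delta> / 3\<close> from \<open>x\<close>, hence in
    \<open>A \<inter> B\<close>. Its distance \<open>\<bar>s\<bar>\<close> from \<open>y\<close> is
    controlled by the distance to \<open>A\<close> or to \<open>B\<close>, according to the sign of
    \<open>s\<close>.\<close>
  have "infdist y (A \<inter> B) \<le> 1 * max (infdist y A) (infdist y B)" if y: "y \<in> cball x (\<delta> / 3)" for y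
  proof -
    define s where "s = n \<bullet> (y - x)"
    define h where "h = y - s *\<^sub>R n"
    have "\<bar>s\<bar> \<le> norm n * norm (y - x)" unfolding s_def by (rule Cauchy_Schwarz_ineq2)
    then have s: "\<bar>s\<bar> \<le> dist y x" using n by (simp add: dist_norm)
    have "dist h x \<le> dist y x + norm (s *\<^sub>R n)"
      unfolding h_def dist_norm using norm_triangle_ineq4[of "y - x" "s *\<^sub>R n"]
      by (simp add: algebra_simps)
    also have "\<dots> < \<delta>" using s y n \<delta> by (simp add: dist_commute)
    finally have "h \<in> A \<inter> B"
      using nn by (intro plane) (auto simp: h_def s_def inner_diff_right)
    then have "infdist y (A \<inter> B) \<le> dist y h" by (rule infdist_le)
    also have "\<dots> = \<bar>s\<bar>" using n by (simp add: h_def dist_norm)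
    also have "\<dots> \<le> max (infdist y A) (infdist y B)"
    proof -
      have "s \<le> infdist y A"
        using inner_le_infdist_if_outer_normal[OF nA, of y] x n by (auto simp: s_def)
      moreover have "- s \<le> infdist y B"
        using inner_le_infdist_if_outer_normal[OF nB, of y] x n by (auto simp: s_def)
      ultimately show ?thesis by linarith
    qed
    finally show ?thesis by simp
  qed
  then show ?thesis using \<delta> unfolding lin_regular_const_def by (auto intro!: exI[of _ "\<delta> / 3"])
qed

section \<open>Convergence of relaxed projections\<close>

lemma norm_relaxed_proj_diff:
  fixes C :: "'a::euclidean_space set"
  assumes "closed C" "C \<noteq> {}"
  shows "norm (relaxed_proj a C x - x) = \<bar>a\<bar> * infdist x C"
proof -
  have "relaxed_proj a C x - x = (- a) *\<^sub>R (x - closest_point C x)"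
    by (simp add: relaxed_proj_def algebra_simps)
  then show ?thesis using infdist_closest_point[OF assms] by simp
qed

lemma tendsto_relaxed_proj:
  fixes C :: "'a::euclidean_space set"
  assumes "closed C" "convex C" "x \<in> C" and "(f \<longlongrightarrow> x) F"
  shows "((\<lambda>i. relaxed_proj a C (f i)) \<longlongrightarrow> x) F"
proof -
  have "((\<lambda>i. closest_point C (f i)) \<longlongrightarrow> closest_point C x) F"
    using assms by (intro isCont_tendsto_compose[OF continuous_at_closest_point]) auto
  then have "((\<lambda>i. closest_point C (f i)) \<longlongrightarrow> x) F"
    using assms by (simp add: closest_point_self)
  then have "((\<lambda>i. relaxed_proj a C (f i)) \<longlongrightarrow> (1 - a) *\<^sub>R x + a *\<^sub>R x) F"
    unfolding relaxed_proj_def using assms by (intro tendsto_intros)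
  then show ?thesis by (simp add: algebra_simps)
qed

text \<open>With \<open>p\<close> and \<open>q\<close> the two closest points, \<open>u' - p\<close>
  equals \<open>- (\<rho>\<^sup>2 *\<^sub>R (u - p)) - a *\<^sub>R (y - q)\<close> because
  \<open>a - 1 = \<rho>\<^sup>2\<close>. Replacing the residuals by multiples of the normals turns
  its inner product with \<open>nC\<close> into the recursion.\<close>

lemma relaxed_proj_two_step_bound:
  fixes C D :: "'a::euclidean_space set"
  assumes C: "closed C" "convex C" "x \<in> C" "unique_unit_normal C x nC"
    and D: "closed D" "convex D" "x \<in> D" "unique_unit_normal D x nD"
    and \<rho>: "0 \<le> \<rho>" "\<rho> \<le> 1" and a: "a = 1 + \<rho>\<^sup>2" "a * (nC \<bullet> nD) = - 2 * \<rho>" and e: "e > 0"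
  shows "\<forall>\<^sub>F u in nhds x. infdist (relaxed_proj a D (relaxed_proj a C u)) C
    \<le> max 0 ((2 * \<rho> + e) * infdist (relaxed_proj a C u) D - \<rho>\<^sup>2 * (1 - e) * infdist u C)"
proof -
  \<comment> \<open>Each residual contributes its error twice, once through the inner product and
    once through the norm of \<open>u' - p\<close>; with \<open>a \<le> 2\<close> this makes a
    factor of at most 4.\<close>
  define \<eta> where "\<eta> = e / 4"
  have \<eta>: "\<eta> > 0" using e by (simp add: \<eta>_def)
  have neC: "C \<noteq> {}" and neD: "D \<noteq> {}" using C D by auto
  have nC: "norm nC = 1" using C by (simp add: unique_unit_normal_def)
  have R1: "((\<lambda>u. relaxed_proj a C u) \<longlongrightarrow> x) (nhds x)"
    by (rule tendsto_relaxed_proj[OF C(1-3)]) (rule tendsto_ident_at[of x UNIV, simplified] filterlim_ident)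
  have R2: "((\<lambda>u. relaxed_proj a D (relaxed_proj a C u)) \<longlongrightarrow> x) (nhds x)"
    by (rule tendsto_relaxed_proj[OF D(1-3) R1])
  note nearC = closest_point_residual_near_normal[OF C \<eta>]
  note nearD = closest_point_residual_near_normal[OF D \<eta>]
  show ?thesis
    using nearC eventually_compose_filterlim[OF nearD R1] eventually_compose_filterlim[OF nearC R2]
  proof eventually_elim
    case (elim u)
    define y where "y = relaxed_proj a C u"
    define u' where "u' = relaxed_proj a D y"
    define p where "p = closest_point C u"
    define q where "q = closest_point D y"
    define b where "b = infdist u C"
    define c where "c = infdist y D"
    have b0: "b \<ge> 0" and c0: "c \<ge> 0" by (auto simp: b_def c_def infdist_nonneg)
    have nb: "norm (u - p) = b" and nc: "norm (y - q) = c"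
      using infdist_closest_point[OF C(1) neC] infdist_closest_point[OF D(1) neD]
      by (auto simp: b_def c_def p_def q_def)
    have a0: "1 \<le> a" "a \<le> 2" using a(1) \<rho> by (auto simp: power_le_one)
    have eq: "u' - p = - (\<rho>\<^sup>2 *\<^sub>R (u - p)) - a *\<^sub>R (y - q)"
    proof -
      have "u' - p = (y - p) - a *\<^sub>R (y - q)"
        by (simp add: u'_def relaxed_proj_def q_def algebra_simps)
      moreover have "y - p = - (\<rho>\<^sup>2 *\<^sub>R (u - p))"
        by (simp add: y_def relaxed_proj_def p_def a(1) algebra_simps)
      ultimately show ?thesis by simp
    qed
    have "b - \<eta> * b \<le> nC \<bullet> (u - p)"
    proof -
      have "\<bar>nC \<bullet> (u - p - b *\<^sub>R nC)\<bar> \<le> norm nC * norm (u - p - b *\<^sub>R nC)"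
        by (rule Cauchy_Schwarz_ineq2)
      also have "\<dots> \<le> \<eta> * b" using elim(1) nC by (simp add: p_def b_def)
      finally show ?thesis using nC by (simp add: inner_diff_right dot_square_norm abs_le_iff)
    qed
    then have l1: "\<rho>\<^sup>2 * (b - \<eta> * b) \<le> \<rho>\<^sup>2 * (nC \<bullet> (u - p))" by (rule mult_left_mono) simp
    have "c * (nC \<bullet> nD) - \<eta> * c \<le> nC \<bullet> (y - q)"
    proof -
      have "\<bar>nC \<bullet> (y - q - c *\<^sub>R nD)\<bar> \<le> norm nC * norm (y - q - c *\<^sub>R nD)"
        by (rule Cauchy_Schwarz_ineq2)
      also have "\<dots> \<le> \<eta> * c" using elim(2) nC by (simp add: q_def c_def y_def)
      finally show ?thesis by (simp add: inner_diff_right abs_le_iff)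
    qed
    then have "a * (c * (nC \<bullet> nD) - \<eta> * c) \<le> a * (nC \<bullet> (y - q))"
      using a0 by (intro mult_left_mono) auto
    moreover have "a * (c * (nC \<bullet> nD)) = - 2 * \<rho> * c"
      using a(2) by (metis mult.assoc mult.commute)
    ultimately have l2: "- 2 * \<rho> * c - a * (\<eta> * c) \<le> a * (nC \<bullet> (y - q))"
      by (simp add: right_diff_distrib)
    have "norm (u' - p) \<le> norm (\<rho>\<^sup>2 *\<^sub>R (u - p)) + norm (a *\<^sub>R (y - q))"
      unfolding eq by (metis norm_minus_cancel norm_triangle_ineq4)
    also have "\<dots> = \<rho>\<^sup>2 * b + a * c" using a0 by (simp add: nb nc)
    finally have l3: "\<eta> * norm (u' - p) \<le> \<eta> * (\<rho>\<^sup>2 * b + a * c)" using \<eta> by simp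
    have "nC \<bullet> (u' - p) = - (\<rho>\<^sup>2 * (nC \<bullet> (u - p))) - a * (nC \<bullet> (y - q))"
      unfolding eq by (simp add: inner_diff_right)
    with l1 l2 l3 have "nC \<bullet> (u' - p) + \<eta> * norm (u' - p)
        \<le> 2 * \<rho> * c - \<rho>\<^sup>2 * b + 2 * (\<eta> * (\<rho>\<^sup>2 * b)) + 2 * (a * (\<eta> * c))"
      by (simp add: algebra_simps)
    also have "\<dots> \<le> (2 * \<rho> + e) * c - \<rho>\<^sup>2 * (1 - e) * b"
    proof -
      have "a * (\<eta> * c) \<le> 2 * (\<eta> * c)" using a0 \<eta> c0 by (intro mult_right_mono) auto
      moreover have "0 \<le> \<eta> * (\<rho>\<^sup>2 * b)" using \<eta> b0 by simp
      moreover have "e = 4 * \<eta>" by (simp add: \<eta>_def)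
      ultimately show ?thesis by (simp add: algebra_simps)
    qed
    finally have fin: "nC \<bullet> (u' - p) + \<eta> * norm (u' - p) \<le> (2 * \<rho> + e) * c - \<rho>\<^sup>2 * (1 - e) * b" .
    \<comment> \<open>Linearising from \<open>p\<close>, where the distance vanishes, leaves only
      the inner product and the error.\<close>
    have "infdist p C = 0" using closest_point_in_set[OF C(1) neC] by (simp add: p_def)
    then have "infdist u' C \<le> max 0 (nC \<bullet> (u' - p) + \<eta> * norm (u' - p))"
      using infdist_le_linearized[OF C(1,2) neC, of u' nC \<eta> p] elim(3) by (simp add: u'_def y_def)
    also have "\<dots> \<le> max 0 ((2 * \<rho> + e) * c - \<rho>\<^sup>2 * (1 - e) * b)" using fin by simp
    finally show ?case by (simp add: u'_def y_def b_def c_def)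
  qed
qed

text \<open>The sequence \<open>u\<close> interleaves the iterates with the half-steps, and
  \<open>E j\<close> is the set projected onto next. The two-step bound, with the roles of the sets
  alternating, then becomes a single scalar recursion for \<open>z\<close>.\<close>

lemma R_linear_conv_relaxed_projections:
  fixes A B :: "'a::euclidean_space set"
  assumes A: "closed A" "convex A" "x \<in> A" "unique_unit_normal A x nA"
    and B: "closed B" "convex B" "x \<in> B" "unique_unit_normal B x nB"
    and \<rho>: "0 \<le> \<rho>" "\<rho> \<le> 1" and a: "a = 1 + \<rho>\<^sup>2" "a * (nA \<bullet> nB) = - 2 * \<rho>"
    and xs: "\<And>k. xs (Suc k) = relaxed_proj a A (relaxed_proj a B (xs k))" "xs \<longlonglongrightarrow> x"
    and \<mu>: "\<rho>\<^sup>2 < \<mu>" "\<mu> < 1"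
  shows "R_linear_conv xs x \<mu>"
proof -
  define E where "E j = (if even j then B else A)" for j :: nat
  define u where "u j = (if even j then xs (j div 2) else relaxed_proj a B (xs (j div 2)))" for j
  define z where "z j = infdist (u j) (E j)" for j
  have uSuc: "u (Suc j) = relaxed_proj a (E j) (u j)" for j
  proof (cases "even j")
    case False
    then have "Suc j div 2 = Suc (j div 2)" by (auto elim!: oddE)
    with False show ?thesis by (simp add: u_def E_def xs(1))
  qed (simp add: u_def E_def)
  have ulim: "u \<longlonglongrightarrow> x"
  proof -
    have "filterlim (\<lambda>j::nat. j div 2) sequentially sequentially"
      unfolding filterlim_at_top
    proof
      fix Z :: nat
      show "\<forall>\<^sub>F j in sequentially. Z \<le> j div 2"
        using eventually_ge_at_top[of "2 * Z"] by eventually_elim linarith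
    qed
    then have l1: "(\<lambda>j. xs (j div 2)) \<longlonglongrightarrow> x" by (rule filterlim_compose[OF xs(2)])
    have l2: "(\<lambda>j. relaxed_proj a B (xs (j div 2))) \<longlonglongrightarrow> x"
      by (rule tendsto_relaxed_proj[OF B(1-3) l1])
    show ?thesis
      unfolding tendsto_def
    proof (intro allI impI)
      fix S assume S: "open S" "x \<in> S"
      show "\<forall>\<^sub>F j in sequentially. u j \<in> S"
        using topological_tendstoD[OF l1 S] topological_tendstoD[OF l2 S]
        by eventually_elim (simp add: u_def)
    qed
  qed
  have "0 \<le> \<mu>" using \<mu>(1) by (meson le_less_trans less_imp_le zero_le_power2)
  \<comment> \<open>The rate per half-step; two half-steps make one iteration.\<close>
  define \<nu> where "\<nu> = sqrt \<mu>"
  have \<nu>: "\<rho> < \<nu>" "\<nu>\<^sup>2 = \<mu>" "\<nu> \<le> 1"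
    using \<mu> \<rho> \<open>0 \<le> \<mu>\<close> by (auto simp: \<nu>_def intro: real_less_rsqrt)
  have z0: "z j \<ge> 0" for j by (simp add: z_def infdist_nonneg)
  have rec: "\<forall>\<^sub>F j in sequentially.
      z (j + 2) \<le> max 0 ((2 * \<rho> + e) * z (j + 1) - \<rho>\<^sup>2 * (1 - e) * z j)" if e: "e > 0" for e
  proof -
    have a': "a * (nB \<bullet> nA) = - 2 * \<rho>" using a(2) by (simp add: inner_commute)
    show ?thesis
      using eventually_compose_filterlim[OF relaxed_proj_two_step_bound[OF A B \<rho> a e] ulim]
        eventually_compose_filterlim[OF relaxed_proj_two_step_bound[OF B A \<rho> a(1) a' e] ulim]
      by eventually_elim (simp add: z_def uSuc E_def)
  qed
  obtain K where K: "K > 0" "\<And>j. z j \<le> K * \<nu> ^ j"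
    using double_root_recursion_bound[OF z0 \<rho>(1) \<nu>(1) rec] by blast
  show ?thesis
  proof (rule R_linear_conv_if_steps_geometric[where C = "4 * K", OF _ _ _ \<mu>(2) xs(2)])
    show "\<mu> > 0" using \<mu>(1) by (meson le_less_trans zero_le_power2)
    show "4 * K > 0" using K by simp
    fix k
    have a0: "1 \<le> a" "a \<le> 2" using a(1) \<rho> by (auto simp: power_le_one)
    \<comment> \<open>A half-step moves by \<open>a * z j\<close> with \<open>a \<le> 2\<close>, so
      the two half-steps of an iteration account for the constant \<open>4 * K\<close>.\<close>
    have st: "norm (u (Suc j) - u j) \<le> 2 * (K * \<nu> ^ (2 * k))" if "2 * k \<le> j" for j
    proof -
      have "A \<noteq> {}" "B \<noteq> {}" using A(3) B(3) by auto
      then have "norm (u (Suc j) - u j) = a * z j"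
        using norm_relaxed_proj_diff[of "E j" a "u j"] a0 A B by (auto simp: uSuc z_def E_def)
      also have "\<dots> \<le> 2 * (K * \<nu> ^ j)"
        using a0 K by (intro mult_mono) (auto simp: z_def infdist_nonneg)
      also have "\<dots> \<le> 2 * (K * \<nu> ^ (2 * k))"
        using K \<nu> \<rho> that by (intro mult_left_mono power_decreasing) auto
      finally show ?thesis .
    qed
    have "xs (Suc k) - xs k = (u (Suc (Suc (2 * k))) - u (Suc (2 * k))) + (u (Suc (2 * k)) - u (2 * k))"
      by (simp add: u_def)
    then have "norm (xs (Suc k) - xs k)
        \<le> norm (u (Suc (Suc (2 * k))) - u (Suc (2 * k))) + norm (u (Suc (2 * k)) - u (2 * k))"
      by (metis norm_triangle_ineq)
    also have "\<dots> \<le> 4 * K * \<nu> ^ (2 * k)"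
      using st[of "2 * k"] st[of "Suc (2 * k)"] by simp
    also have "\<nu> ^ (2 * k) = \<mu> ^ k" using \<nu>(2) by (simp add: power_mult)
    finally show "norm (xs (Suc k) - xs k) \<le> 4 * K * \<mu> ^ k" .
  qed
qed

section \<open>From the regularity constant to the relaxation parameter and the rate\<close>

theorem theorem10:
  fixes A B :: "'a::euclidean_space set" and xs :: "nat \<Rightarrow> 'a" and xstar :: 'a and k :: nat
  defines "\<kappa> \<equiv> Inf {\<kappa>'. lin_regular_const A B xstar \<kappa>'}"
  defines "\<alpha>' \<equiv> 2 * (\<kappa> / (sqrt (\<kappa>\<^sup>2 - 1) + 1))\<^sup>2"
  defines "\<gamma> \<equiv> ((sqrt (\<kappa>\<^sup>2 - 1) - 1) / (sqrt (\<kappa>\<^sup>2 - 1) + 1))\<^sup>2"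
  assumes "solid A" "closed A" "convex A"
    and "solid B" "closed B" "convex B"
    and "\<And>n. xs (Suc n) = gap_step 1 \<alpha>' \<alpha>' A B (xs n)"
    and "xs \<longlonglongrightarrow> xstar"
    and "xstar \<in> frontier A \<inter> frontier B"
    and "regularity_assumption k (frontier A) (frontier B) xstar"
  shows "(\<exists>\<kappa>'. lin_regular_const A B xstar \<kappa>') \<and>
         (\<kappa> \<ge> sqrt 2 \<longrightarrow> (\<forall>\<mu>. \<gamma> < \<mu> \<and> \<mu> < 1 \<longrightarrow> R_linear_conv xs xstar \<mu>))"
proof -
  have x: "xstar \<in> frontier A" "xstar \<in> frontier B" using assms by auto
  have xA: "xstar \<in> A" and xB: "xstar \<in> B"
    using x assms(5,8) frontier_subset_closed by blast+
  have k: "2 \<le> k" and mA: "Ck_manifold_around k (frontier A) xstar"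
    and mB: "Ck_manifold_around k (frontier B) xstar"
    and mAB: "Ck_manifold_around k (frontier A \<inter> frontier B) xstar"
    and T: "tangent_space k (frontier A \<inter> frontier B) xstar
      = tangent_space k (frontier A) xstar \<inter> tangent_space k (frontier B) xstar"
    using assms(13) unfolding regularity_assumption_def by auto
  obtain nA where nA: "unique_unit_normal A xstar nA"
    and TA: "tangent_space k (frontier A) xstar = {v. nA \<bullet> v = 0}"
    using tangent_space_frontier_convex[OF assms(5,6,4) x(1) k mA] .
  obtain nB where nB: "unique_unit_normal B xstar nB"
    and TB: "tangent_space k (frontier B) xstar = {v. nB \<bullet> v = 0}"
    using tangent_space_frontier_convex[OF assms(8,9,7) x(2) k mB] .
  note A = assms(5,6) xA nA and B = assms(8,9) xB nB
  show ?thesis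
  proof (cases "nA + nB = 0")
    \<comment> \<open>For opposite normals \<open>1\<close> is a regularity constant, so
      \<open>\<kappa> \<le> 1 < sqrt 2\<close> and the claim about the rate is vacuous.\<close>
    case True
    then have nB_eq: "nB = - nA" by (simp add: add_eq_0_iff)
    have "lin_regular_const A B xstar 1"
      using nA nB T TA TB unfolding unique_unit_normal_def nB_eq
      by (intro lin_regular_const_opposite_normals[OF assms(5,8) x _ _ _ k mAB, of nA]) auto
    moreover from this have "\<kappa> \<le> 1"
      unfolding \<kappa>_def by (intro cInf_lower bdd_belowI[of _ 0]) (auto simp: lin_regular_const_def)
    moreover have "1 < sqrt 2" by simp
    ultimately show ?thesis by (smt (verit))
  next
    case False
    have \<kappa>: "\<kappa> = 2 / norm (nA + nB)"
      unfolding \<kappa>_def by (rule Inf_lin_regular_const_eq[OF A B False])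
    have "R_linear_conv xs xstar \<mu>" if \<kappa>2: "\<kappa> \<ge> sqrt 2" and \<mu>: "\<gamma> < \<mu>" "\<mu> < 1" for \<mu>
    proof -
      define s where "s = sqrt (\<kappa>\<^sup>2 - 1)"
      define \<rho> where "\<rho> = (s - 1) / (s + 1)"
      \<comment> \<open>The bound on \<open>\<kappa>\<close> enters as \<open>s \<ge> 1\<close>,
        which makes \<open>\<rho>\<close> nonnegative.\<close>
      have "(sqrt 2)\<^sup>2 \<le> \<kappa>\<^sup>2" using \<kappa>2 by (intro power_mono) auto
      then have s: "s \<ge> 1" "\<kappa>\<^sup>2 = s\<^sup>2 + 1" by (auto simp: s_def)
      have s1: "s + 1 \<noteq> 0" using s by simp
      have s2: "s\<^sup>2 + 1 \<noteq> 0" by (metis add.commute power_one sum_power2_eq_zero_iff zero_neq_one)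
      have \<alpha>: "\<alpha>' = 2 * (s\<^sup>2 + 1) / (s + 1)\<^sup>2"
      proof -
        have "\<alpha>' = 2 * \<kappa>\<^sup>2 / (s + 1)\<^sup>2" by (simp add: \<alpha>'_def s_def power_divide)
        then show ?thesis by (simp only: s(2))
      qed
      have "norm (nA + nB) ^ 2 = 2 + 2 * (nA \<bullet> nB)"
      proof -
        have "nA \<bullet> nA = 1" "nB \<bullet> nB = 1"
          using nA nB by (auto simp: unique_unit_normal_def dot_square_norm)
        then show ?thesis by (simp add: power2_norm_eq_inner inner_add inner_commute)
      qed
      moreover have "norm (nA + nB) ^ 2 = 4 / \<kappa>\<^sup>2"
        using False by (simp add: \<kappa> power_divide)
      ultimately have c: "nA \<bullet> nB = (1 - s\<^sup>2) / (s\<^sup>2 + 1)"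
        using s2 by (simp add: s(2) field_simps)
      \<comment> \<open>This is the identity
        \<open>(s + 1)\<^sup>2 + (s - 1)\<^sup>2 = 2 * (s\<^sup>2 + 1)\<close>.\<close>
      have "\<alpha>' = 1 + \<rho>\<^sup>2"
        using s1 by (simp add: \<alpha> \<rho>_def power_divide field_simps) (simp add: power2_eq_square algebra_simps)
      moreover have "\<alpha>' * (nA \<bullet> nB) = - 2 * \<rho>"
      proof -
        have "\<alpha>' * (nA \<bullet> nB) = 2 * (1 - s\<^sup>2) / (s + 1)\<^sup>2"
          using nonzero_mult_divide_mult_cancel_right[OF s2, of "2 * (1 - s\<^sup>2)" "(s + 1)\<^sup>2"]
          by (simp only: \<alpha> c times_divide_times_eq mult.assoc mult.commute[of "1 - s\<^sup>2"])
        also have "\<dots> = (- 2 * (s - 1)) * (s + 1) / ((s + 1) * (s + 1))"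
          by (intro arg_cong2[where f = "(/)"]) (simp_all add: power2_eq_square algebra_simps)
        also have "\<dots> = - 2 * (s - 1) / (s + 1)"
          by (rule nonzero_mult_divide_mult_cancel_right[OF s1])
        also have "\<dots> = - 2 * \<rho>" by (simp add: \<rho>_def)
        finally show ?thesis .
      qed
      moreover have "0 \<le> \<rho>" "\<rho> \<le> 1" using s by (auto simp: \<rho>_def)
      moreover have "\<rho>\<^sup>2 < \<mu>" using \<mu> by (simp add: \<gamma>_def \<rho>_def s_def)
      moreover have "xs (Suc n) = relaxed_proj \<alpha>' A (relaxed_proj \<alpha>' B (xs n))" for n
        by (simp add: assms(10) gap_step_def)
      ultimately show ?thesis
        using R_linear_conv_relaxed_projections[OF A B] assms(11) \<mu>(2) by blast
    qed
    moreover have "lin_regular_const A B xstar (2 / norm (nA + nB) + 1)"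
      by (rule lin_regular_const_if_gt[OF A B False]) simp
    ultimately show ?thesis by blast
  qed
qed

end
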